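(* Let $(X,L)$ be an $n$-dimensional polarized toric manifold associated to an integral Delzant polytope $P=\{x\in\mathbf{R}^n\mid\langle\lambda_j,x\rangle+d_j\ge0\ (j=1,\dots,r)\}$. Fix a point $x_0$ in the interior of $P$, put $d_{x_0,j}=\langle\lambda_j,x_0\rangle+d_j$ for $j=1,\dots,r$, and let $d_{x_0}=\max\{d_{x_0,1},\dots,d_{x_0,r}\}$. Suppose that $P$ satisfies either $$V=0\quad\text{and}\quad\overline{s}<\frac{n+1}{d_{x_0}},$$ or $$V\ne0\quad\text{and}\quad\overline{s}+\max_PV\le\frac{n+1}{d_{x_0}}.$$ Then $(X,L)$ is uniformly relatively K-polystable.
   Context: In the presentation of the integral Delzant polytope $P$, $r$ is the number of facets, $\lambda_j\in\mathbf{Z}^n$ is primitive, $d_j\in\mathbf{Z}$, and $F_j=\{x\in P\mid\langle\lambda_j,x\rangle+d_j=0\}$ are the facets. $\sigma$ is the Borel measure on $\partial P$ equal on $F_j$ to $|\lambda_j|^{-1}$ times $(n-1)$-dimensional Lebesgue measure; $\overline{s}=\sigma(\partial P)/\mathrm{vol}(P)$; $V$ is the unique affine function on $P$ such that $\int_{\partial P}\ell\,d\sigma=\int_P(\overline{s}+V)\ell\,dx$ for every affine $\ell$ (it corresponds to the extremal Kähler vector field of $(X,L)$). $L_V(f)=\int_{\partial P}f\,d\sigma-\int_P(\overline{s}+V)f\,dx$. $\mathcal{C}_{PL}^{\mathbf{Q}}$ is the set of rational piecewise affine convex functions on $P$ (maxima of finitely many affine functions with rational coefficients). $\|f\|_J=\inf_{\xi\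 \mathrm{affine}}\big(\frac1{\mathrm{vol}(P)}\int_P(f+\xi)\,dx-\inf_P(f+\xi)\big)$. $(X,L)$ is uniformly relatively K-polystable if there exists $\delta>0$ such that $L_V(f)\ge\delta\|f\|_J$ for all $f\in\mathcal{C}_{PL}^{\mathbf{Q}}$. *)

theory Defs
  imports "HOL-Analysis.Analysis"
begin

definition of_int_vec :: "int ^ 'n \<Rightarrow> real ^ 'n" where
  "of_int_vec v = (\<chi> i. real_of_int (v $ i))"

definition primitive_vec :: "int ^ 'n \<Rightarrow> bool" where
  "primitive_vec v \<longleftrightarrow> Gcd (range (\<lambda>i. v $ i)) = 1"

definition int_basis :: "nat set \<Rightarrow> (nat \<Rightarrow> int ^ 'n) \<Rightarrow> bool" where
  "int_basis J b \<longleftrightarrow>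
     finite J \<and> (\<forall>w. \<exists>!c. (\<forall>j. j \<notin> J \<longrightarrow> c j = 0) \<and> w = (\<Sum>j\<in>J. c j *s b j))"

text \<open>
  A polytope is given by its number \<open>r\<close> of facets, the inner normals \<open>lam 1, \<dots>, lam r\<close>
  and the constants \<open>d 1, \<dots>, d r\<close>.
\<close>

definition support_fn :: "(nat \<Rightarrow> int ^ 'n) \<Rightarrow> (nat \<Rightarrow> int) \<Rightarrow> nat \<Rightarrow> real ^ 'n \<Rightarrow> real" where
  "support_fn lam d j x = of_int_vec (lam j) \<bullet> x + real_of_int (d j)"

definition presented_polytope :: "nat \<Rightarrow> (nat \<Rightarrow> int ^ 'n) \<Rightarrow> (nat \<Rightarrow> int) \<Rightarrow> (real ^ 'n) set" where
  "presented_polytope r lam d = {x. \<forall>j\<in>{1..r}. support_fn lam d j x \<ge> 0}"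

definition facet_set ::
    "nat \<Rightarrow> (nat \<Rightarrow> int ^ 'n) \<Rightarrow> (nat \<Rightarrow> int) \<Rightarrow> nat \<Rightarrow> (real ^ 'n) set" where
  "facet_set r lam d j = {x \<in> presented_polytope r lam d. support_fn lam d j x = 0}"

text \<open>
  The bijection condition says that the presentation is irredundant. The last condition is the
  Delzant condition: at each vertex the normals of the facets through it form a basis of the
  lattice (so that exactly \<open>n\<close> facets meet there).
\<close>

definition integral_delzant :: "nat \<Rightarrow> (nat \<Rightarrow> int ^ 'n) \<Rightarrow> (nat \<Rightarrow> int) \<Rightarrow> bool" where
  "integral_delzant r lam d \<longleftrightarrow>
     (let P = presented_polytope r lam d in
       polytope P \<and> interior P \<noteq> {} \<and>
       (\<forall>j\<in>{1..r}. primitive_vec (lam j)) \<and>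
       bij_betw (facet_set r lam d) {1..r} {F. F facet_of P} \<and>
       (\<forall>v. v extreme_point_of P \<longrightarrow> v \<in> range of_int_vec) \<and>
       (\<forall>v. v extreme_point_of P \<longrightarrow> int_basis {j\<in>{1..r}. v \<in> facet_set r lam d j} lam))"

text \<open>
  Lebesgue measure of dimension \<open>n - 1\<close> on the hyperplane \<open>a \<bullet> x + b = 0\<close> for \<open>a \<noteq> 0\<close>, viewed as
  a Borel measure on the ambient space: as in the definition of \<^term>\<open>lborel\<close>, it is the product of
  one-dimensional Lebesgue measures in orthonormal coordinates, with the foot of the perpendicular
  from the origin as base point. By rotation and translation invariance it does not depend on
  these choices. For \<open>n = 1\<close> the basis is empty and the measure is a unit point mass.
\<close>

definition orthonormal_basis_of :: "'a::euclidean_space set \<Rightarrow> 'a set \<Rightarrow> bool" where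
  "orthonormal_basis_of S B \<longleftrightarrow> pairwise orthogonal B \<and> (\<forall>u\<in>B. norm u = 1) \<and> span B = S"

lemma orthonormal_basis_of_exists:
  assumes "subspace S"
  shows "\<exists>B. orthonormal_basis_of S B"
  using orthonormal_basis_subspace[OF assms] unfolding orthonormal_basis_of_def by metis

definition hyperplane_lborel :: "'a::euclidean_space \<Rightarrow> real \<Rightarrow> 'a measure" where
  "hyperplane_lborel a b =
     (let B = (SOME B. orthonormal_basis_of {x. a \<bullet> x = 0} B) in
       distr (\<Pi>\<^sub>M u\<in>B. lborel) borel (\<lambda>t. - (b / (a \<bullet> a)) *\<^sub>R a + (\<Sum>u\<in>B. t u *\<^sub>R u)))"

text \<open>
  The measure \<open>\<sigma>\<close>, as a Borel measure on the ambient space concentrated on the boundary of the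
  polytope. Distinct facets meet in null sets, so on each facet the sum reduces to a single term.
\<close>

definition boundary_measure ::
    "nat \<Rightarrow> (nat \<Rightarrow> int ^ 'n) \<Rightarrow> (nat \<Rightarrow> int) \<Rightarrow> (real ^ 'n) measure" where
  "boundary_measure r lam d = measure_of UNIV (sets borel)
     (\<lambda>A. \<Sum>j=1..r. ennreal (1 / norm (of_int_vec (lam j))) *
        emeasure (hyperplane_lborel (of_int_vec (lam j)) (real_of_int (d j)))
          (A \<inter> facet_set r lam d j))"

lemma sets_hyperplane_lborel [simp, measurable_cong]: "sets (hyperplane_lborel a b) = sets borel"
  by (simp add: hyperplane_lborel_def Let_def)

lemma sets_boundary_measure [simp, measurable_cong]: "sets (boundary_measure r lam d) = sets borel"
proof -
  have "sigma_sets UNIV (sets (borel :: (real ^ 'n) measure)) = sets borel"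
    using sets.sigma_sets_eq[of "borel :: (real ^ 'n) measure"] by simp
  then show ?thesis by (simp add: boundary_measure_def)
qed

lemma facet_set_borel [measurable]: "facet_set r lam d j \<in> sets borel"
proof -
  have c: "continuous_on UNIV (support_fn lam d i)" for i
    unfolding support_fn_def by (intro continuous_intros)
  have "facet_set r lam d j =
     (\<Inter>i\<in>{1..r}. {x. 0 \<le> support_fn lam d i x}) \<inter> {x. support_fn lam d j x = 0}"
    by (auto simp: facet_set_def presented_polytope_def)
  moreover have "closed ((\<Inter>i\<in>{1..r}. {x. 0 \<le> support_fn lam d i x}) \<inter> {x. support_fn lam d j x = 0})"
    by (intro closed_Int closed_INT ballI closed_Collect_le closed_Collect_eq c continuous_on_const)
  ultimately show ?thesis by (simp add: borel_closed)
qed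

lemma emeasure_boundary_measure:
  assumes A: "A \<in> sets borel"
  shows "emeasure (boundary_measure r lam d) A =
    (\<Sum>j=1..r. ennreal (1 / norm (of_int_vec (lam j))) *
        emeasure (hyperplane_lborel (of_int_vec (lam j)) (real_of_int (d j)))
          (A \<inter> facet_set r lam d j))"
proof (rule emeasure_measure_of[OF boundary_measure_def])
  show "positive (sets (boundary_measure r lam d)) (\<lambda>A. \<Sum>j=1..r. ennreal (1 / norm (of_int_vec (lam j))) *
        emeasure (hyperplane_lborel (of_int_vec (lam j)) (real_of_int (d j))) (A \<inter> facet_set r lam d j))"
    by (simp add: positive_def)
  show "countably_additive (sets (boundary_measure r lam d)) (\<lambda>A. \<Sum>j=1..r. ennreal (1 / norm (of_int_vec (lam j))) *
        emeasure (hyperplane_lborel (of_int_vec (lam j)) (real_of_int (d j))) (A \<inter> facet_set r lam d j))"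
  proof (rule countably_additiveI)
    fix X :: "nat \<Rightarrow> (real ^ 'a) set"
    assume X: "range X \<subseteq> sets (boundary_measure r lam d)" "disjoint_family X"
    have "(\<Sum>i. emeasure (hyperplane_lborel (of_int_vec (lam j)) (real_of_int (d j))) (X i \<inter> facet_set r lam d j))
        = emeasure (hyperplane_lborel (of_int_vec (lam j)) (real_of_int (d j))) (\<Union> (range X) \<inter> facet_set r lam d j)" for j
      using X by (subst suminf_emeasure)
        (auto simp: disjoint_family_on_def intro!: sets.Int facet_set_borel arg_cong[where f = "emeasure _"])
    then show "(\<Sum>i. \<Sum>j=1..r. ennreal (1 / norm (of_int_vec (lam j))) *
          emeasure (hyperplane_lborel (of_int_vec (lam j)) (real_of_int (d j))) (X i \<inter> facet_set r lam d j)) =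
        (\<Sum>j=1..r. ennreal (1 / norm (of_int_vec (lam j))) *
          emeasure (hyperplane_lborel (of_int_vec (lam j)) (real_of_int (d j))) (\<Union> (range X) \<inter> facet_set r lam d j))"
      by (subst suminf_sum) auto
  qed
qed (use A in auto)

definition boundary_integral ::
    "nat \<Rightarrow> (nat \<Rightarrow> int ^ 'n) \<Rightarrow> (nat \<Rightarrow> int) \<Rightarrow> (real ^ 'n \<Rightarrow> real) \<Rightarrow> real" where
  "boundary_integral r lam d f =
     (LINT x:frontier (presented_polytope r lam d)|boundary_measure r lam d. f x)"

definition polytope_integral ::
    "nat \<Rightarrow> (nat \<Rightarrow> int ^ 'n) \<Rightarrow> (nat \<Rightarrow> int) \<Rightarrow> (real ^ 'n \<Rightarrow> real) \<Rightarrow> real" where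
  "polytope_integral r lam d f = (LINT x:presented_polytope r lam d|lborel. f x)"

definition polytope_vol :: "nat \<Rightarrow> (nat \<Rightarrow> int ^ 'n) \<Rightarrow> (nat \<Rightarrow> int) \<Rightarrow> real" where
  "polytope_vol r lam d = measure lborel (presented_polytope r lam d)"

definition s_bar :: "nat \<Rightarrow> (nat \<Rightarrow> int ^ 'n) \<Rightarrow> (nat \<Rightarrow> int) \<Rightarrow> real" where
  "s_bar r lam d =
     measure (boundary_measure r lam d) (frontier (presented_polytope r lam d)) /
       polytope_vol r lam d"

definition affine_fns :: "('a::euclidean_space \<Rightarrow> real) set" where
  "affine_fns = {l. \<exists>a c. l = (\<lambda>x. a \<bullet> x + c)}"

text \<open>
  Since the polytope has nonempty interior, affine functions on it are identified with affine
  functions on the ambient space.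
\<close>

definition extremal_fn ::
    "nat \<Rightarrow> (nat \<Rightarrow> int ^ 'n) \<Rightarrow> (nat \<Rightarrow> int) \<Rightarrow> real ^ 'n \<Rightarrow> real" where
  "extremal_fn r lam d = (THE V. V \<in> affine_fns \<and>
     (\<forall>l\<in>affine_fns. boundary_integral r lam d l =
        polytope_integral r lam d (\<lambda>x. (s_bar r lam d + V x) * l x)))"

definition L_V :: "nat \<Rightarrow> (nat \<Rightarrow> int ^ 'n) \<Rightarrow> (nat \<Rightarrow> int) \<Rightarrow> (real ^ 'n \<Rightarrow> real) \<Rightarrow> real" where
  "L_V r lam d f = boundary_integral r lam d f -
     polytope_integral r lam d (\<lambda>x. (s_bar r lam d + extremal_fn r lam d x) * f x)"

text \<open>Only the values on the polytope are constrained, the functions being functions on it.\<close>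

definition rational_PL_convex ::
    "nat \<Rightarrow> (nat \<Rightarrow> int ^ 'n) \<Rightarrow> (nat \<Rightarrow> int) \<Rightarrow> (real ^ 'n \<Rightarrow> real) set" where
  "rational_PL_convex r lam d =
     {f. \<exists>S :: ((real ^ 'n) \<times> real) set. finite S \<and> S \<noteq> {} \<and>
        (\<forall>(a, c)\<in>S. (\<forall>i. a $ i \<in> \<rat>) \<and> c \<in> \<rat>) \<and>
        (\<forall>x\<in>presented_polytope r lam d. f x = Max ((\<lambda>(a, c). a \<bullet> x + c) ` S))}"

definition J_norm :: "nat \<Rightarrow> (nat \<Rightarrow> int ^ 'n) \<Rightarrow> (nat \<Rightarrow> int) \<Rightarrow> (real ^ 'n \<Rightarrow> real) \<Rightarrow> real" where
  "J_norm r lam d f = (INF \<xi>\<in>affine_fns.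
     1 / polytope_vol r lam d * polytope_integral r lam d (\<lambda>x. f x + \<xi> x) -
     (INF x\<in>presented_polytope r lam d. f x + \<xi> x))"

text \<open>
  Uniform relative K-polystability of the polarized toric manifold associated with the polytope,
  expressed as usual on the polytope itself.
\<close>

definition uniformly_relatively_K_polystable ::
    "nat \<Rightarrow> (nat \<Rightarrow> int ^ 'n) \<Rightarrow> (nat \<Rightarrow> int) \<Rightarrow> bool" where
  "uniformly_relatively_K_polystable r lam d \<longleftrightarrow>
     (\<exists>\<delta>>0. \<forall>f\<in>rational_PL_convex r lam d. L_V r lam d f \<ge> \<delta> * J_norm r lam d f)"

end

theory Submission imports Defs begin

text \<open>
  Decomposing \<open>P\<close> into the cones with apex \<open>x0\<close> over its facets gives, in polar coordinates,
  \<open>\<integral>\<^sub>P G dx = (\<Sum>j. d\<^sub>j \<integral>\<^bsub>F\<^sub>j\<^esub> (\<integral>\<^sub>0\<^sup>1 u\<^bsup>n-1\<^esup> G(x0 + u (y - x0)) du) d\<sigma>(y))\<close>, where \<open>d\<^sub>j\<close> is the value at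
  \<open>x0\<close> of the \<open>j\<close>-th defining function. Since \<open>L\<^sub>V\<close> vanishes on affine functions, one may assume that the
  convex function \<open>f\<close> is nonnegative and vanishes at \<open>x0\<close>, so that \<open>f(x0 + u (y - x0)) \<le> u f(y)\<close>.
  The hypothesis says that the affine function \<open>h = n + 1 - D (s + V)\<close>, with \<open>D\<close> the largest of the \<open>d\<^sub>j\<close>,
  is nonnegative on \<open>P\<close> and positive at \<open>x0\<close>, hence \<open>h(x0 + u (y - x0)) \<ge> c (1 - u)\<close>. This gain on
  each ray yields \<open>D \<integral>\<^bsub>\<partial>P\<^esub> f d\<sigma> \<ge> \<integral>\<^sub>P (D (s + V) + \<delta>) f dx\<close> with \<open>\<delta> = c / (n + 2)\<close>, and \<open>\<integral>\<^sub>P f dx\<close> bounds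
  \<open>vol(P)\<close> times the J-norm from above.
\<close>

section \<open>Lebesgue measure in orthonormal coordinates\<close>

lemma nn_integral_lborel_translation:
  fixes t :: "'a::euclidean_space"
  assumes [measurable]: "f \<in> borel_measurable borel"
  shows "(\<integral>\<^sup>+x. f (t + x) \<partial>lborel) = (\<integral>\<^sup>+x. f x \<partial>lborel)"
proof -
  have "(lborel :: 'a measure) = distr lborel borel (\<lambda>x. t + x)"
    using lborel_affine[of 1 t] by (simp add: density_1)
  then have "(\<integral>\<^sup>+x. f x \<partial>lborel) = (\<integral>\<^sup>+x. f x \<partial>distr lborel borel (\<lambda>x. t + x))"
    by (rule arg_cong)
  also have "\<dots> = (\<integral>\<^sup>+x. f (t + x) \<partial>lborel)"
    by (simp add: nn_integral_distr)
  finally show ?thesis ..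
qed

text \<open>Uniqueness of translation invariant measures: integrate \<open>1\<^sub>A(x) 1\<^sub>B(x - T y)\<close> for the unit ball
  \<open>B\<close> against Lebesgue measure in \<open>x\<close> and \<open>y\<close>, in both orders.\<close>
lemma lborel_distr_orthogonal_transformation:
  fixes T :: "'a::euclidean_space \<Rightarrow> 'a"
  assumes T: "orthogonal_transformation T"
  shows "distr lborel borel T = lborel"
proof (rule measure_eqI)
  have lin: "linear T" and nT: "norm (T x) = norm x" for x
    using T by (auto simp: orthogonal_transformation)
  have [measurable]: "T \<in> borel_measurable borel"
    using lin by (intro borel_measurable_continuous_onI linear_continuous_on) (simp add: linear_conv_bounded_linear)
  fix A :: "'a set" assume "A \<in> sets (distr lborel borel T)"
  then have [measurable]: "A \<in> sets borel" by simp
  define B where "B = ball (0::'a) 1"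
  have [measurable]: "B \<in> sets borel" by (simp add: B_def)
  have surj: "\<exists>z. T z = x" for x
    using orthogonal_transformation_surj[OF T] by (metis surjD)
  \<comment> \<open>Since \<open>T\<close> preserves norms, the preimage under \<open>T\<close> of
    the unit ball around \<open>x = T z\<close> is the unit ball around \<open>z\<close>, which has
    the measure of \<open>B\<close> by translation invariance.\<close>
  have 1: "(\<integral>\<^sup>+y. indicator B (x - T y) \<partial>lborel) = emeasure lborel B" for x
  proof -
    obtain z where z: "T z = x" using surj by blast
    have "(\<integral>\<^sup>+y. indicator B (x - T y) \<partial>lborel) = (\<integral>\<^sup>+y. indicator B (y - z) \<partial>lborel)"
      unfolding z[symmetric] linear_diff[OF lin, symmetric]
      by (intro nn_integral_cong) (auto simp: B_def nT norm_minus_commute indicator_def)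
    also have "\<dots> = (\<integral>\<^sup>+y. indicator B y \<partial>lborel)"
      using nn_integral_lborel_translation[of "indicator B" "- z"] by simp
    finally show ?thesis by simp
  qed
  have 2: "(\<integral>\<^sup>+y. indicator A (T y + x) \<partial>lborel) = emeasure (distr lborel borel T) A" for x
  proof -
    obtain z where z: "T z = x" using surj by blast
    have "(\<integral>\<^sup>+y. indicator A (T y + x) \<partial>lborel) = (\<integral>\<^sup>+y. indicator A (T (z + y)) \<partial>lborel)"
      by (simp add: linear_add[OF lin] z add.commute)
    also have "\<dots> = (\<integral>\<^sup>+y. indicator A (T y) \<partial>lborel)"
      by (rule nn_integral_lborel_translation) measurable
    also have "\<dots> = (\<integral>\<^sup>+y. indicator (T -` A) y \<partial>lborel)"
      by (intro nn_integral_cong) (auto simp: indicator_def)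
    also have "\<dots> = emeasure lborel (T -` A)"
      by (rule nn_integral_indicator) (use measurable_sets_borel[of T borel A] in simp)
    finally show ?thesis by (simp add: emeasure_distr)
  qed
  have "emeasure lborel A * emeasure lborel B =
      (\<integral>\<^sup>+x. indicator A x * (\<integral>\<^sup>+y. indicator B (x - T y) \<partial>lborel) \<partial>lborel)"
    by (simp add: 1 nn_integral_multc)
  also have "\<dots> = (\<integral>\<^sup>+x. \<integral>\<^sup>+y. indicator A x * indicator B (x - T y) \<partial>lborel \<partial>lborel)"
    by (intro nn_integral_cong nn_integral_cmult[symmetric]) measurable
  also have "\<dots> = (\<integral>\<^sup>+y. \<integral>\<^sup>+x. indicator A x * indicator B (x - T y) \<partial>lborel \<partial>lborel)"
    by (rule lborel_pair.Fubini'[symmetric]) measurable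
  also have "\<dots> = (\<integral>\<^sup>+y. \<integral>\<^sup>+x. indicator A (T y + x) * indicator B x \<partial>lborel \<partial>lborel)"
  proof (rule nn_integral_cong)
    fix y
    have "(\<integral>\<^sup>+x. indicator A (T y + x) * indicator B (T y + x - T y) \<partial>lborel)
      = (\<integral>\<^sup>+x. indicator A x * indicator B (x - T y) \<partial>lborel)"
      by (rule nn_integral_lborel_translation) measurable
    then show "(\<integral>\<^sup>+x. indicator A x * indicator B (x - T y) \<partial>lborel) =
      (\<integral>\<^sup>+x. indicator A (T y + x) * indicator B x \<partial>lborel)" by simp
  qed
  also have "\<dots> = (\<integral>\<^sup>+x. \<integral>\<^sup>+y. indicator A (T y + x) * indicator B x \<partial>lborel \<partial>lborel)"
    by (rule lborel_pair.Fubini') measurable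
  also have "\<dots> = (\<integral>\<^sup>+x. (\<integral>\<^sup>+y. indicator A (T y + x) \<partial>lborel) * indicator B x \<partial>lborel)"
    by (intro nn_integral_cong nn_integral_multc) measurable
  also have "\<dots> = emeasure (distr lborel borel T) A * emeasure lborel B"
    by (simp add: 2 nn_integral_cmult)
  finally have "emeasure lborel A * emeasure lborel B = emeasure (distr lborel borel T) A * emeasure lborel B" .
  \<comment> \<open>Cancelling the factor in \<open>ennreal\<close> needs it to be neither zero nor
    infinite.\<close>
  moreover have "emeasure lborel B \<noteq> \<infinity>" "emeasure lborel B \<noteq> 0"
    using emeasure_lborel_ball_finite[of "0::'a" 1] content_ball_pos[of 1 "0::'a"]
    by (auto simp: B_def measure_def)
  ultimately show "emeasure (distr lborel borel T) A = emeasure lborel A"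
    by (simp add: ennreal_mult_cancel_left mult.commute[of _ "emeasure lborel B"])
qed simp

section \<open>Coordinates with respect to an orthonormal basis\<close>

lemma orthonormal_inner:
  assumes "pairwise orthogonal B" "\<And>u. u \<in> B \<Longrightarrow> norm u = 1" "u \<in> B" "v \<in> B"
  shows "u \<bullet> v = (if u = v then 1 else 0)"
  using assms by (auto simp: pairwise_def orthogonal_def norm_eq_1)

lemma inner_orthonormal_coords:
  assumes B: "finite B" "pairwise orthogonal B" "\<And>u. u \<in> B \<Longrightarrow> norm u = 1" and v: "v \<in> B"
  shows "(\<Sum>u\<in>B. t u *\<^sub>R u) \<bullet> v = t v"
proof -
  have "(\<Sum>u\<in>B. t u *\<^sub>R u) \<bullet> v = (\<Sum>u\<in>B. if u = v then t u else 0)"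
    unfolding inner_sum_left using v by (intro sum.cong) (auto simp: orthonormal_inner[OF B(2,3)])
  also have "\<dots> = t v" using B(1) v by simp
  finally show ?thesis .
qed

lemma orthonormal_expansion:
  assumes B: "finite B" "pairwise orthogonal B" "\<And>u. u \<in> B \<Longrightarrow> norm u = 1" and x: "x \<in> span B"
  shows "(\<Sum>u\<in>B. (x \<bullet> u) *\<^sub>R u) = x"
proof -
  obtain t where t: "x = (\<Sum>u\<in>B. t u *\<^sub>R u)"
    using x by (auto simp: span_finite[OF B(1)])
  show ?thesis unfolding t by (intro sum.cong) (simp_all add: inner_orthonormal_coords[OF B])
qed

text \<open>An orthogonal map \<open>T\<close> taking \<open>B\<close> to the standard basis carries
  the product measure to one that gives every box its volume, so the image is \<open>lborel\<close>.
  Undoing \<open>T\<close> changes nothing, because \<open>lborel\<close> is invariant under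
  orthogonal maps.\<close>

lemma lborel_orthonormal_basis:
  fixes B :: "'a::euclidean_space set"
  assumes B: "pairwise orthogonal B" "\<And>u. u \<in> B \<Longrightarrow> norm u = 1" "span B = UNIV"
  shows "lborel = distr (\<Pi>\<^sub>M u\<in>B. lborel) borel (\<lambda>t. \<Sum>u\<in>B. t u *\<^sub>R u)"
proof -
  have ind: "independent B" using B by (intro pairwise_orthogonal_independent) (auto dest: B(2)[of 0])
  then have fin: "finite B" by (simp add: independent_bound)
  have "card B = DIM('a)" using ind B(3) by (metis dim_UNIV dim_span_eq_card_independent)
  then obtain p where p: "bij_betw p (Basis :: 'a set) B"
    using finite_same_card_bij[of "Basis :: 'a set" B] fin by (metis finite_Basis)
  \<comment> \<open>\<open>T\<close> reads off the coordinates along \<open>B\<close> and uses them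
    as standard coordinates; \<open>p\<close> matches the basis vectors.\<close>
  define T where "T x = (\<Sum>e\<in>Basis. (x \<bullet> p e) *\<^sub>R e)" for x :: 'a
  have pB: "p e \<in> B" if "e \<in> Basis" for e using p that by (auto simp: bij_betw_def)
  have sumB: "(\<Sum>e\<in>Basis. f (p e)) = (\<Sum>u\<in>B. f u)" for f :: "'a \<Rightarrow> real"
    by (rule sum.reindex_bij_betw[OF p])
  have "orthogonal_transformation T"
    unfolding orthogonal_transformation_def
  proof (intro conjI allI)
    show "linear T" unfolding T_def
      by (intro linearI) (simp_all add: inner_add_left scaleR_add_left sum.distrib scaleR_sum_right)
    fix v w :: 'a
    have "T v \<bullet> T w = (\<Sum>e\<in>Basis. (T v \<bullet> e) * (T w \<bullet> e))" by (rule euclidean_inner)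
    also have "\<dots> = (\<Sum>e\<in>Basis. (v \<bullet> p e) * (w \<bullet> p e))"
      by (intro sum.cong refl) (simp add: T_def)
    also have "\<dots> = (\<Sum>u\<in>B. (v \<bullet> u) * (w \<bullet> u))" by (rule sumB[of "\<lambda>u. (v \<bullet> u) * (w \<bullet> u)"])
    also have "\<dots> = (\<Sum>u\<in>B. (v \<bullet> u) *\<^sub>R u) \<bullet> w"
      by (simp only: inner_sum_left inner_scaleR_left) (simp add: inner_commute)
    also have "\<dots> = v \<bullet> w" using B(3) by (simp add: orthonormal_expansion[OF fin B(1,2)])
    finally show "T v \<bullet> T w = v \<bullet> w" .
  qed
  note orth = this
  have lin: "linear T" using orth by (simp add: orthogonal_transformation_linear)
  have inj: "inj T" using orth by (rule orthogonal_transformation_inj)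
  have [measurable]: "T \<in> borel_measurable borel" unfolding T_def by measurable
  let ?E = "\<lambda>t. \<Sum>u\<in>B. t u *\<^sub>R u"
  have E[measurable]: "?E \<in> borel_measurable (\<Pi>\<^sub>M u\<in>B. lborel)"
    by measurable
  interpret product_sigma_finite "\<lambda>_::'a. lborel :: real measure" ..
  let ?N = "distr (\<Pi>\<^sub>M u\<in>B. lborel) borel ?E"
  have "lborel = distr ?N borel T"
  proof (rule lborel_eqI)
    fix l u :: 'a assume le: "\<And>b. b \<in> Basis \<Longrightarrow> l \<bullet> b \<le> u \<bullet> b"
    let ?q = "the_inv_into Basis p"
    have q: "?q v \<in> Basis" "p (?q v) = v" if "v \<in> B" for v
      using p that by (auto simp: bij_betw_def the_inv_into_into f_the_inv_into_f)
    have "(T \<circ> ?E) -` box l u \<inter> space (\<Pi>\<^sub>M u\<in>B. lborel) = Pi\<^sub>E B (\<lambda>v. {l \<bullet> ?q v<..<u \<bullet> ?q v})"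
    proof -
      have "T (?E t) \<bullet> e = t (p e)" if "e \<in> Basis" for t e
        using that by (simp add: T_def inner_orthonormal_coords[OF fin B(1,2)] pB)
      then have 1: "(T \<circ> ?E) t \<in> box l u \<longleftrightarrow> (\<forall>e\<in>Basis. t (p e) \<in> {l \<bullet> e<..<u \<bullet> e})" for t
        by (simp add: mem_box)
      have 2: "(\<forall>e\<in>Basis. t (p e) \<in> {l \<bullet> e<..<u \<bullet> e}) \<longleftrightarrow> (\<forall>v\<in>B. t v \<in> {l \<bullet> ?q v<..<u \<bullet> ?q v})" for t :: "'a \<Rightarrow> real"
        using q p by (metis pB bij_betw_def the_inv_into_f_f)
      show ?thesis unfolding vimage_def 1 2 by (auto simp: space_PiM PiE_iff)
    qed
    moreover have "emeasure (distr ?N borel T) (box l u)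
       = emeasure (\<Pi>\<^sub>M u\<in>B. lborel) ((T \<circ> ?E) -` box l u \<inter> space (\<Pi>\<^sub>M u\<in>B. lborel))"
      by (simp add: distr_distr emeasure_distr)
    ultimately have "emeasure (distr ?N borel T) (box l u) = (\<Prod>v\<in>B. emeasure lborel {l \<bullet> ?q v<..<u \<bullet> ?q v})"
      using fin by (simp add: emeasure_PiM)
    also have "\<dots> = (\<Prod>v\<in>B. ennreal ((u - l) \<bullet> ?q v))"
      by (intro prod.cong refl) (simp add: le q inner_diff_left)
    also have "\<dots> = (\<Prod>e\<in>Basis. ennreal ((u - l) \<bullet> e))"
      unfolding prod.reindex_bij_betw[OF p, symmetric]
      using p by (intro prod.cong refl) (simp add: bij_betw_def the_inv_into_f_f)
    also have "\<dots> = ennreal (\<Prod>e\<in>Basis. (u - l) \<bullet> e)"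
      by (intro prod_ennreal) (simp add: le inner_diff_left)
    finally show "emeasure (distr ?N borel T) (box l u) = ennreal (\<Prod>e\<in>Basis. (u - l) \<bullet> e)" .
  qed simp
  have N: "distr ?N borel T = lborel" using \<open>lborel = distr ?N borel T\<close> by simp
  show ?thesis
  proof (rule measure_eqI)
    fix A :: "'a set" assume "A \<in> sets lborel"
    then have A[measurable]: "A \<in> sets borel" by simp
    obtain T' where T': "orthogonal_transformation T'" "\<And>x. T' (T x) = x"
      using orth by (metis inj inv_f_f orthogonal_transformation_inv)
    have [measurable]: "T' \<in> borel_measurable borel"
      using orthogonal_transformation_linear[OF T'(1)]
      by (intro borel_measurable_continuous_onI linear_continuous_on) (simp add: linear_conv_bounded_linear)
    have "distr (distr ?N borel T) borel T' = ?N"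
      by (simp add: distr_distr o_def T'(2))
    then show "emeasure lborel A = emeasure ?N A"
      by (simp add: N lborel_distr_orthogonal_transformation[OF T'(1)])
  qed simp
qed

text \<open>Each coordinate contributes one factor \<open>\<bar>s\<bar>\<close> by the
  one-dimensional substitution rule, and induction on \<open>B\<close> collects
  \<open>card B\<close> of them. With \<open>B\<close> spanning the directions of a hyperplane this
  produces the factor \<open>s ^ (n - 1)\<close> of polar coordinates.\<close>

lemma nn_integral_PiM_lborel_affine:
  fixes s :: real
  assumes B: "finite B" and s: "s \<noteq> 0" and f: "f \<in> borel_measurable (\<Pi>\<^sub>M u\<in>B. lborel)"
  shows "(\<integral>\<^sup>+t. f t \<partial>(\<Pi>\<^sub>M u\<in>B. lborel)) =
    ennreal (\<bar>s\<bar> ^ card B) * (\<integral>\<^sup>+t. f (\<lambda>u\<in>B. p u + s * t u) \<partial>(\<Pi>\<^sub>M u\<in>B. lborel))"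
  using B f
proof (induction B arbitrary: f rule: finite_induct)
  case empty
  have "(\<integral>\<^sup>+t. f t \<partial>(\<Pi>\<^sub>M u\<in>{}. lborel)) = (\<integral>\<^sup>+t. f (\<lambda>u\<in>{}. p u + s * t u) \<partial>(\<Pi>\<^sub>M u\<in>{}. lborel))"
    by (intro nn_integral_cong) (simp add: space_PiM restrict_def)
  then show ?case by (simp only: card.empty power_0 ennreal_1 mult_1)
next
  case (insert i I)
  interpret product_sigma_finite "\<lambda>_. lborel :: real measure" ..
  note [measurable] = insert.prems
  have upd[measurable]: "(\<lambda>(x, y). x(i := y)) \<in> (\<Pi>\<^sub>M u\<in>I. lborel) \<Otimes>\<^sub>M lborel \<rightarrow>\<^sub>M (\<Pi>\<^sub>M u\<in>insert i I. (lborel :: real measure))"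
    by (rule measurable_add_dim)
  have fup[measurable]: "(\<lambda>(x, y). f (x(i := p i + s * y))) \<in> borel_measurable ((\<Pi>\<^sub>M u\<in>I. lborel) \<Otimes>\<^sub>M lborel)"
  proof -
    have "(\<lambda>z. f ((\<lambda>(x, y). x(i := y)) (fst z, p i + s * snd z))) \<in> borel_measurable ((\<Pi>\<^sub>M u\<in>I. lborel) \<Otimes>\<^sub>M lborel)"
      by measurable
    then show ?thesis by (simp add: case_prod_beta)
  qed
  have aff[measurable]: "(\<lambda>t. \<lambda>u\<in>insert i I. p u + s * t u) \<in> (\<Pi>\<^sub>M u\<in>insert i I. lborel) \<rightarrow>\<^sub>M (\<Pi>\<^sub>M u\<in>insert i I. lborel)"
    by (rule measurable_restrict) measurable
  have "(\<integral>\<^sup>+t. f t \<partial>(\<Pi>\<^sub>M u\<in>insert i I. lborel)) = (\<integral>\<^sup>+x. (\<integral>\<^sup>+y. f (x(i := y)) \<partial>lborel) \<partial>(\<Pi>\<^sub>M u\<in>I. lborel))"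
    by (rule product_nn_integral_insert) (use insert in auto)
  also have "\<dots> = (\<integral>\<^sup>+x. ennreal \<bar>s\<bar> * (\<integral>\<^sup>+y. f (x(i := p i + s * y)) \<partial>lborel) \<partial>(\<Pi>\<^sub>M u\<in>I. lborel))"
  proof (rule nn_integral_cong)
    fix x :: "_ \<Rightarrow> real" assume "x \<in> space (\<Pi>\<^sub>M u\<in>I. lborel)"
    then have [measurable]: "(\<lambda>y. x(i := y)) \<in> lborel \<rightarrow>\<^sub>M (\<Pi>\<^sub>M u\<in>insert i I. lborel)"
      using insert by (intro measurable_component_update) auto
    have "(\<lambda>y. f (x(i := y))) \<in> borel_measurable lborel" by measurable
    then show "(\<integral>\<^sup>+y. f (x(i := y)) \<partial>lborel) = ennreal \<bar>s\<bar> * (\<integral>\<^sup>+y. f (x(i := p i + s * y)) \<partial>lborel)"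
      by (intro nn_integral_real_affine s) simp
  qed
  also have "\<dots> = ennreal \<bar>s\<bar> * (\<integral>\<^sup>+x. (\<integral>\<^sup>+y. f (x(i := p i + s * y)) \<partial>lborel) \<partial>(\<Pi>\<^sub>M u\<in>I. lborel))"
    by (intro nn_integral_cmult) measurable
  also have "\<dots> = ennreal \<bar>s\<bar> * (ennreal (\<bar>s\<bar> ^ card I) *
      (\<integral>\<^sup>+x. (\<integral>\<^sup>+y. f ((\<lambda>u\<in>I. p u + s * x u)(i := p i + s * y)) \<partial>lborel) \<partial>(\<Pi>\<^sub>M u\<in>I. lborel)))"
    by (subst insert.IH) simp_all
  also have "(\<lambda>x y. f ((\<lambda>u\<in>I. p u + s * x u)(i := p i + s * y))) =
      (\<lambda>x y. f (\<lambda>u\<in>insert i I. p u + s * (x(i := y)) u))"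
    using insert.hyps by (intro ext arg_cong[where f=f]) auto
  also have "(\<integral>\<^sup>+x. (\<integral>\<^sup>+y. f (\<lambda>u\<in>insert i I. p u + s * (x(i := y)) u) \<partial>lborel) \<partial>(\<Pi>\<^sub>M u\<in>I. lborel)) =
      (\<integral>\<^sup>+t. f (\<lambda>u\<in>insert i I. p u + s * t u) \<partial>(\<Pi>\<^sub>M u\<in>insert i I. lborel))"
    by (rule product_nn_integral_insert[symmetric]) (use insert in auto)
  finally show ?case
    using insert.hyps by (simp add: ennreal_mult mult.assoc del: restrict_apply insert_iff)
qed

text \<open>Removing from a vector its component along the unit normal leaves a vector of the
  hyperplane, so the normal completes the basis. The cardinality becomes the exponent of the radial
  Jacobian.\<close>

lemma orthonormal_basis_of_hyperplane_insert:
  fixes a :: "'a::euclidean_space"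
  assumes a: "a \<noteq> 0" and B: "orthonormal_basis_of {x. a \<bullet> x = 0} B"
  defines "e \<equiv> a /\<^sub>R norm a"
  shows "pairwise orthogonal (insert e B)" "\<And>u. u \<in> insert e B \<Longrightarrow> norm u = 1"
    "span (insert e B) = UNIV" "e \<notin> B" "finite B" "card B = DIM('a) - 1"
proof -
  have BH: "a \<bullet> u = 0" if "u \<in> B" for u
    using B that span_base[of u B] by (auto simp: orthonormal_basis_of_def)
  have ae: "a \<bullet> e \<noteq> 0" using a by (simp add: e_def)
  show orth: "pairwise orthogonal (insert e B)"
    using B BH by (auto simp: orthonormal_basis_of_def pairwise_insert orthogonal_def e_def inner_commute)
  show nrm: "norm u = 1" if "u \<in> insert e B" for u
    using B that a by (auto simp: orthonormal_basis_of_def e_def)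
  have "x \<in> span (insert e B)" for x
  proof -
    have "a \<bullet> (x - (x \<bullet> e) *\<^sub>R e) = 0"
    proof -
      have "a \<bullet> e = norm a" using a by (simp add: e_def dot_square_norm power2_eq_square)
      moreover have "x \<bullet> e = (a \<bullet> x) / norm a" by (simp add: e_def inner_commute[of x] divide_inverse)
      ultimately show ?thesis using a by (simp add: inner_diff_right)
    qed
    then have "x - (x \<bullet> e) *\<^sub>R e \<in> span B" using B by (simp add: orthonormal_basis_of_def)
    then show ?thesis unfolding span_insert by blast
  qed
  then show sp: "span (insert e B) = UNIV" by auto
  show e: "e \<notin> B" using BH ae by auto
  have "0 \<notin> insert e B" using nrm[of 0] by (metis norm_zero zero_neq_one)
  then have ind: "independent (insert e B)"
    using orth by (metis pairwise_orthogonal_independent)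
  then have "finite (insert e B)" by (metis independent_bound)
  then show fin: "finite B" by simp
  have "card (insert e B) = DIM('a)" using ind sp by (metis dim_UNIV dim_span_eq_card_independent)
  then show "card B = DIM('a) - 1" using fin e by simp
qed

section \<open>Polar coordinates over a hyperplane\<close>

text \<open>Unpacks the choice operator once; later arguments only use that the chosen
  \<open>B\<close> is an orthonormal basis.\<close>

lemma hyperplane_lborel_orthonormal:
  fixes a :: "'a::euclidean_space"
  obtains B where "orthonormal_basis_of {x. a \<bullet> x = 0} B"
    "hyperplane_lborel a b =
      distr (\<Pi>\<^sub>M u\<in>B. lborel) borel (\<lambda>t. - (b / (a \<bullet> a)) *\<^sub>R a + (\<Sum>u\<in>B. t u *\<^sub>R u))"
proof -
  define B where "B = (SOME B. orthonormal_basis_of {x. a \<bullet> x = 0} B)"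
  have "orthonormal_basis_of {x. a \<bullet> x = 0} B"
    unfolding B_def by (rule someI_ex) (intro orthonormal_basis_of_exists subspace_hyperplane)
  then show thesis using that[of B] by (simp add: hyperplane_lborel_def Let_def B_def)
qed

text \<open>Polar coordinates centred at \<open>x0\<close>: \<open>x = x0 + s (y - x0)\<close> with \<open>y\<close> in the hyperplane, whose
  distance from \<open>x0\<close> is \<open>D / norm a\<close>.\<close>
lemma nn_integral_lborel_cone:
  fixes a x0 :: "'a::euclidean_space"
  assumes G[measurable]: "G \<in> borel_measurable borel" and a: "a \<noteq> 0"
    and D: "D = a \<bullet> x0 + b" "0 < D"
  shows "(\<integral>\<^sup>+x. G x * indicator {x. a \<bullet> x + b < D} x \<partial>lborel) =
    ennreal (D / norm a) * (\<integral>\<^sup>+s. ennreal (s ^ (DIM('a) - 1)) * indicator {0<..} s *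
      (\<integral>\<^sup>+y. G (x0 + s *\<^sub>R (y - x0)) \<partial>hyperplane_lborel a b) \<partial>lborel)"
proof -
  obtain B where B: "orthonormal_basis_of {x. a \<bullet> x = 0} B"
    and H: "hyperplane_lborel a b =
      distr (\<Pi>\<^sub>M u\<in>B. lborel) borel (\<lambda>t. - (b / (a \<bullet> a)) *\<^sub>R a + (\<Sum>u\<in>B. t u *\<^sub>R u))"
    by (rule hyperplane_lborel_orthonormal)
  define e where "e = a /\<^sub>R norm a"
  note eB = orthonormal_basis_of_hyperplane_insert[OF a B, folded e_def]
  note [simp] = eB(4,5)
  interpret product_sigma_finite "\<lambda>_::'a. lborel :: real measure" ..
  have N: "norm a > 0" "a = norm a *\<^sub>R e" "a \<bullet> a = norm a * norm a"
    using a by (auto simp: e_def dot_square_norm power2_eq_square)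
  have ae: "a \<bullet> e = norm a" using a by (simp add: e_def dot_square_norm power2_eq_square)
  have aB: "a \<bullet> u = 0" if "u \<in> B" for u
    using B that span_base[of u B] by (auto simp: orthonormal_basis_of_def)
  define \<alpha> where "\<alpha> = x0 \<bullet> e"
  have x0: "x0 = \<alpha> *\<^sub>R e + (\<Sum>u\<in>B. (x0 \<bullet> u) *\<^sub>R u)"
    using orthonormal_expansion[OF _ eB(1,2), of x0] eB(3) by (simp add: \<alpha>_def)
  have D': "D = norm a * \<alpha> + b" using N(2) by (metis D(1) \<alpha>_def inner_commute inner_scaleR_left)
  let ?F = "\<lambda>x. G x * indicator {x. a \<bullet> x + b < D} x"
  let ?I = "\<lambda>\<tau>. \<integral>\<^sup>+t. ?F (\<tau> *\<^sub>R e + (\<Sum>u\<in>B. t u *\<^sub>R u)) \<partial>(\<Pi>\<^sub>M u\<in>B. lborel)"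
  have "(\<integral>\<^sup>+x. ?F x \<partial>lborel) =
      (\<integral>\<^sup>+t. ?F (\<Sum>u\<in>insert e B. t u *\<^sub>R u) \<partial>(\<Pi>\<^sub>M u\<in>insert e B. lborel))"
    by (subst lborel_orthonormal_basis[OF eB(1,2,3)]) (simp_all add: nn_integral_distr)
  also have "\<dots> = (\<integral>\<^sup>+\<tau>. \<integral>\<^sup>+t. ?F (\<Sum>u\<in>insert e B. (t(e := \<tau>)) u *\<^sub>R u) \<partial>(\<Pi>\<^sub>M u\<in>B. lborel) \<partial>lborel)"
    by (rule product_nn_integral_insert_rev) simp_all
  also have "\<dots> = (\<integral>\<^sup>+\<tau>. ?I \<tau> \<partial>lborel)"
  proof -
    have "(\<Sum>u\<in>insert e B. (t(e := \<tau>)) u *\<^sub>R u) = \<tau> *\<^sub>R e + (\<Sum>u\<in>B. t u *\<^sub>R u)" for t :: "'a \<Rightarrow> real" and \<tau>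
    proof -
      have "(\<Sum>u\<in>B. (t(e := \<tau>)) u *\<^sub>R u) = (\<Sum>u\<in>B. t u *\<^sub>R u)" by (intro sum.cong) auto
      then show ?thesis by simp
    qed
    then show ?thesis by simp
  qed
  \<comment> \<open>The normal coordinate is substituted so that
    \<open>a \<bullet> x + b = D - D * s\<close>: the value \<open>s = 0\<close> is the level of
    \<open>x0\<close>, and \<open>s = 1\<close> is the hyperplane itself.\<close>
  also have "\<dots> = ennreal (D / norm a) * (\<integral>\<^sup>+s. ?I (\<alpha> + (- D / norm a) * s) \<partial>lborel)"
  proof -
    interpret sigma_finite_measure "\<Pi>\<^sub>M u\<in>B. (lborel :: real measure)"
      by (rule sigma_finite) simp
    have "?I \<in> borel_measurable borel" by measurable
    moreover have "- D / norm a \<noteq> 0" using D(2) a by simp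
    ultimately have "(\<integral>\<^sup>+\<tau>. ?I \<tau> \<partial>lborel) =
        ennreal \<bar>- D / norm a\<bar> * (\<integral>\<^sup>+s. ?I (\<alpha> + (- D / norm a) * s) \<partial>lborel)"
      by (rule nn_integral_real_affine)
    moreover have "\<bar>- D / norm a\<bar> = D / norm a" using D(2) by simp
    ultimately show ?thesis by (simp only:)
  qed
  also have "(\<integral>\<^sup>+s. ?I (\<alpha> + (- D / norm a) * s) \<partial>lborel) =
      (\<integral>\<^sup>+s. ennreal (s ^ (DIM('a) - 1)) * indicator {0<..} s *
        (\<integral>\<^sup>+y. G (x0 + s *\<^sub>R (y - x0)) \<partial>hyperplane_lborel a b) \<partial>lborel)"
  proof (rule nn_integral_cong)
    fix s :: real
    let ?\<tau> = "\<alpha> + (- D / norm a) * s"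
    have ind: "a \<bullet> (?\<tau> *\<^sub>R e + (\<Sum>u\<in>B. t u *\<^sub>R u)) + b < D \<longleftrightarrow> 0 < s" for t
    proof -
      have "a \<bullet> (?\<tau> *\<^sub>R e + (\<Sum>u\<in>B. t u *\<^sub>R u)) + b = ?\<tau> * norm a + b"
        by (simp add: inner_add_right inner_sum_right aB ae)
      also have "\<dots> = D - D * s" using N(1) by (simp add: D' field_simps)
      finally show ?thesis using D(2) by (simp add: zero_less_mult_iff)
    qed
    then have ind: "indicator {x. a \<bullet> x + b < D} (?\<tau> *\<^sub>R e + (\<Sum>u\<in>B. t u *\<^sub>R u)) = (indicator {0<..} s :: ennreal)" for t
      by (simp add: indicator_def)
    show "?I ?\<tau> = ennreal (s ^ (DIM('a) - 1)) * indicator {0<..} s *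
        (\<integral>\<^sup>+y. G (x0 + s *\<^sub>R (y - x0)) \<partial>hyperplane_lborel a b)"
    proof (cases "0 < s")
      case False
      then show ?thesis unfolding ind by simp
    next
      case True
      have "?I ?\<tau> = (\<integral>\<^sup>+t. G (?\<tau> *\<^sub>R e + (\<Sum>u\<in>B. t u *\<^sub>R u)) \<partial>(\<Pi>\<^sub>M u\<in>B. lborel))"
        using True unfolding ind by simp
      \<comment> \<open>If \<open>y\<close> has tangential coordinates \<open>t\<close>, those of
        \<open>x0 + s (y - x0)\<close> are \<open>(1 - s) * (x0 \<bullet> u) + s * t u\<close>; this
        dictates the shift.\<close>
      also have "\<dots> = ennreal (\<bar>s\<bar> ^ card B) * (\<integral>\<^sup>+t. G (?\<tau> *\<^sub>R e +
          (\<Sum>u\<in>B. (\<lambda>u\<in>B. (1 - s) * (x0 \<bullet> u) + s * t u) u *\<^sub>R u)) \<partial>(\<Pi>\<^sub>M u\<in>B. lborel))"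
        using True by (subst nn_integral_PiM_lborel_affine[where s=s and p="\<lambda>u. (1 - s) * (x0 \<bullet> u)"]) simp_all
      also have "(\<lambda>t. G (?\<tau> *\<^sub>R e + (\<Sum>u\<in>B. (\<lambda>u\<in>B. (1 - s) * (x0 \<bullet> u) + s * t u) u *\<^sub>R u))) =
         (\<lambda>t. G (x0 + s *\<^sub>R ((- (b / (a \<bullet> a)) *\<^sub>R a + (\<Sum>u\<in>B. t u *\<^sub>R u)) - x0)))"
      proof (intro ext arg_cong[where f=G])
        fix t :: "'a \<Rightarrow> real"
        have "(\<Sum>u\<in>B. (\<lambda>u\<in>B. (1 - s) * (x0 \<bullet> u) + s * t u) u *\<^sub>R u) =
          (1 - s) *\<^sub>R (\<Sum>u\<in>B. (x0 \<bullet> u) *\<^sub>R u) + s *\<^sub>R (\<Sum>u\<in>B. t u *\<^sub>R u)"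
          by (simp add: scaleR_sum_right scaleR_add_left sum.distrib)
        also have "(\<Sum>u\<in>B. (x0 \<bullet> u) *\<^sub>R u) = x0 - \<alpha> *\<^sub>R e" using x0 by (simp add: algebra_simps)
        finally have 1: "(\<Sum>u\<in>B. (\<lambda>u\<in>B. (1 - s) * (x0 \<bullet> u) + s * t u) u *\<^sub>R u) =
          (1 - s) *\<^sub>R (x0 - \<alpha> *\<^sub>R e) + s *\<^sub>R (\<Sum>u\<in>B. t u *\<^sub>R u)" .
        have 2: "(b / (a \<bullet> a)) *\<^sub>R a = (b / norm a) *\<^sub>R e"
          using N(1,3) by (simp add: e_def divide_inverse mult.assoc)
        \<comment> \<open>The hyperplane has normal coordinate \<open>- b / norm a\<close>, so the
          normal direction too is interpolated with weights \<open>1 - s\<close> and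
          \<open>s\<close>.\<close>
        have 3: "?\<tau> = (1 - s) * \<alpha> - s * (b / norm a)"
          using N(1) by (simp add: D' field_simps)
        show "?\<tau> *\<^sub>R e + (\<Sum>u\<in>B. (\<lambda>u\<in>B. (1 - s) * (x0 \<bullet> u) + s * t u) u *\<^sub>R u) =
          x0 + s *\<^sub>R ((- (b / (a \<bullet> a)) *\<^sub>R a + (\<Sum>u\<in>B. t u *\<^sub>R u)) - x0)"
          unfolding 1 3 scaleR_minus_left 2 by (simp add: algebra_simps)
      qed
      finally show ?thesis
        using True by (simp add: H nn_integral_distr eB(6))
    qed
  qed
  finally show ?thesis .
qed

text \<open>Coordinates are inner products with unit vectors, so Cauchy-Schwarz places those of a
  bounded set in a cube, whose product measure is finite.\<close>

lemma emeasure_hyperplane_lborel_bounded: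
  fixes a :: "'a::euclidean_space"
  assumes a: "a \<noteq> 0" and A: "A \<in> sets borel" "bounded A"
  shows "emeasure (hyperplane_lborel a b) A < \<infinity>"
proof -
  obtain B where B: "orthonormal_basis_of {x. a \<bullet> x = 0} B"
    and H: "hyperplane_lborel a b =
      distr (\<Pi>\<^sub>M u\<in>B. lborel) borel (\<lambda>t. - (b / (a \<bullet> a)) *\<^sub>R a + (\<Sum>u\<in>B. t u *\<^sub>R u))"
    by (rule hyperplane_lborel_orthonormal)
  note eB = orthonormal_basis_of_hyperplane_insert[OF a B]
  interpret product_sigma_finite "\<lambda>_::'a. lborel :: real measure" ..
  let ?E = "\<lambda>t. - (b / (a \<bullet> a)) *\<^sub>R a + (\<Sum>u\<in>B. t u *\<^sub>R u)"
  obtain R where "0 < R" and R: "\<And>x. x \<in> A \<Longrightarrow> norm x \<le> R" using A(2) by (auto simp: bounded_pos)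
  have aB: "a \<bullet> u = 0" "norm u = 1" if "u \<in> B" for u
    using B that span_base[of u B] by (auto simp: orthonormal_basis_of_def)
  have "?E -` A \<inter> space (\<Pi>\<^sub>M u\<in>B. lborel) \<subseteq> Pi\<^sub>E B (\<lambda>_. {-R..R})"
  proof (rule subsetI, rule PiE_I)
    fix t u assume "t \<in> ?E -` A \<inter> space (\<Pi>\<^sub>M u\<in>B. lborel)" and u: "u \<in> B"
    then have t: "?E t \<in> A" by simp
    have "?E t \<bullet> u = t u"
      using u aB B inner_orthonormal_coords[OF eB(5) _ aB(2) u, of t]
      by (simp add: inner_diff_left orthonormal_basis_of_def)
    then have "\<bar>t u\<bar> \<le> norm (?E t) * norm u" by (metis Cauchy_Schwarz_ineq2)
    then show "t u \<in> {-R..R}" using R[OF t] aB(2)[OF u] by auto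
  qed (auto simp: space_PiM PiE_iff extensional_def)
  then have "emeasure (\<Pi>\<^sub>M u\<in>B. lborel) (?E -` A \<inter> space (\<Pi>\<^sub>M u\<in>B. lborel)) \<le>
      emeasure (\<Pi>\<^sub>M u\<in>B. lborel) (Pi\<^sub>E B (\<lambda>_. {-R..R}))"
    by (rule emeasure_mono) (use eB(5) in \<open>auto intro!: sets_PiM_I_finite\<close>)
  also have "\<dots> = (\<Prod>u\<in>B. emeasure lborel {-R..R})"
    by (rule emeasure_PiM) (use eB(5) in auto)
  also have "\<dots> < \<infinity>"
    using \<open>0 < R\<close> by (simp add: ennreal_power)
  finally show ?thesis using A(1) by (simp add: H emeasure_distr)
qed

lemma AE_hyperplane_lborel:
  fixes a :: "'a::euclidean_space"
  assumes a: "a \<noteq> 0"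
  shows "AE y in hyperplane_lborel a b. a \<bullet> y + b = 0"
proof -
  obtain B where B: "orthonormal_basis_of {x. a \<bullet> x = 0} B"
    and H: "hyperplane_lborel a b =
      distr (\<Pi>\<^sub>M u\<in>B. lborel) borel (\<lambda>t. - (b / (a \<bullet> a)) *\<^sub>R a + (\<Sum>u\<in>B. t u *\<^sub>R u))"
    by (rule hyperplane_lborel_orthonormal)
  have aB: "a \<bullet> u = 0" if "u \<in> B" for u
    using B that span_base[of u B] by (auto simp: orthonormal_basis_of_def)
  have "a \<bullet> (- (b / (a \<bullet> a)) *\<^sub>R a + (\<Sum>u\<in>B. t u *\<^sub>R u)) + b = 0" for t :: "'a \<Rightarrow> real"
    using a by (simp add: inner_diff_right inner_sum_right aB)
  then show ?thesis unfolding H by (subst AE_distr_iff) (auto simp del: add_uminus_conv_diff)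
qed

text \<open>Here \<open>\<sigma> x\<close> recovers the radial coordinate of \<open>x\<close>, and
  \<open>K\<close> is the cone with apex \<open>x0\<close> over the part of \<open>F\<close> in the
  hyperplane, truncated there and without its apex. A bound that separates into a radial factor and
  a factor on \<open>F\<close> turns polar coordinates into a product of two integrals.\<close>

lemma nn_integral_cone_le:
  fixes a x0 :: "'a::euclidean_space"
  assumes G[measurable]: "G \<in> borel_measurable borel" and g[measurable]: "g \<in> borel_measurable borel"
    and k[measurable]: "k \<in> borel_measurable borel" and F[measurable]: "F \<in> sets borel"
    and a: "a \<noteq> 0" and D: "D = a \<bullet> x0 + b" "0 < D"
    and le: "\<And>y s. y \<in> F \<Longrightarrow> 0 < s \<Longrightarrow> s \<le> 1 \<Longrightarrow> G (x0 + s *\<^sub>R (y - x0)) \<le> k s * g y"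
  defines "\<sigma> \<equiv> \<lambda>x. (D - (a \<bullet> x + b)) / D"
  defines "K \<equiv> {x. 0 < \<sigma> x \<and> \<sigma> x \<le> 1 \<and> x0 + (1 / \<sigma> x) *\<^sub>R (x - x0) \<in> F}"
  shows "(\<integral>\<^sup>+x. G x * indicator K x \<partial>lborel) \<le>
    ennreal (D / norm a) * ((\<integral>\<^sup>+s. ennreal (s ^ (DIM('a) - 1)) * k s * indicator {0..1} s \<partial>lborel) *
      (\<integral>\<^sup>+y. g y * indicator F y \<partial>hyperplane_lborel a b))"
proof -
  let ?H = "hyperplane_lborel a b"
  have \<sigma>[measurable]: "\<sigma> \<in> borel_measurable borel" unfolding \<sigma>_def by measurable
  have K[measurable]: "K \<in> sets borel" unfolding K_def by measurable
  have \<sigma>_pos: "0 < \<sigma> x \<longleftrightarrow> a \<bullet> x + b < D" for x using D(2) by (simp add: \<sigma>_def zero_less_divide_iff)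
  have "(\<integral>\<^sup>+x. G x * indicator K x \<partial>lborel) =
      (\<integral>\<^sup>+x. (G x * indicator K x) * indicator {x. a \<bullet> x + b < D} x \<partial>lborel)"
    by (intro nn_integral_cong) (auto simp: K_def \<sigma>_pos indicator_def)
  also have "\<dots> = ennreal (D / norm a) * (\<integral>\<^sup>+s. ennreal (s ^ (DIM('a) - 1)) * indicator {0<..} s *
      (\<integral>\<^sup>+y. G (x0 + s *\<^sub>R (y - x0)) * indicator K (x0 + s *\<^sub>R (y - x0)) \<partial>?H) \<partial>lborel)"
    by (rule nn_integral_lborel_cone[OF _ a D]) measurable
  also have "\<dots> \<le> ennreal (D / norm a) * (\<integral>\<^sup>+s. (ennreal (s ^ (DIM('a) - 1)) * k s * indicator {0..1} s) *
      (\<integral>\<^sup>+y. g y * indicator F y \<partial>?H) \<partial>lborel)"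
  proof (intro mult_left_mono nn_integral_mono)
    fix s :: real
    \<comment> \<open>For \<open>y\<close> on the hyperplane, \<open>\<sigma>\<close> returns
      \<open>s\<close> at \<open>x0 + s (y - x0)\<close>, so membership in \<open>K\<close> becomes
      \<open>s \<le> 1\<close> and \<open>y \<in> F\<close>. The measure is concentrated on such
      \<open>y\<close>, hence the almost-everywhere form.\<close>
    have AE: "AE y in ?H. G (x0 + s *\<^sub>R (y - x0)) * indicator K (x0 + s *\<^sub>R (y - x0)) \<le>
        (k s * indicator {0..1} s) * (g y * indicator F y)" if s: "0 < s"
      using AE_hyperplane_lborel[OF a, of b]
    proof eventually_elim
      case (elim y)
      have "D - (a \<bullet> (x0 + s *\<^sub>R (y - x0)) + b) = s * D - s * (a \<bullet> y + b)"
        by (simp add: D(1) inner_add_right inner_diff_right algebra_simps)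
      then have "\<sigma> (x0 + s *\<^sub>R (y - x0)) = s" using D(2) elim by (simp add: \<sigma>_def)
      then have "x0 + s *\<^sub>R (y - x0) \<in> K \<longleftrightarrow> s \<le> 1 \<and> y \<in> F"
        using s by (simp add: K_def)
      then show ?case using le[of y s] s by (auto simp: indicator_def)
    qed
    show "ennreal (s ^ (DIM('a) - 1)) * indicator {0<..} s *
      (\<integral>\<^sup>+y. G (x0 + s *\<^sub>R (y - x0)) * indicator K (x0 + s *\<^sub>R (y - x0)) \<partial>?H) \<le>
      (ennreal (s ^ (DIM('a) - 1)) * k s * indicator {0..1} s) * (\<integral>\<^sup>+y. g y * indicator F y \<partial>?H)"
    proof (cases "0 < s")
      case True
      then have "(\<integral>\<^sup>+y. G (x0 + s *\<^sub>R (y - x0)) * indicator K (x0 + s *\<^sub>R (y - x0)) \<partial>?H) \<le>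
        (\<integral>\<^sup>+y. (k s * indicator {0..1} s) * (g y * indicator F y) \<partial>?H)"
        by (intro nn_integral_mono_AE AE)
      also have "\<dots> = (k s * indicator {0..1} s) * (\<integral>\<^sup>+y. g y * indicator F y \<partial>?H)"
        by (rule nn_integral_cmult) simp
      finally show ?thesis using True by (auto simp: mult.assoc intro!: mult_left_mono)
    qed simp
  qed simp
  also have "\<dots> = ennreal (D / norm a) * ((\<integral>\<^sup>+s. ennreal (s ^ (DIM('a) - 1)) * k s * indicator {0..1} s \<partial>lborel) *
      (\<integral>\<^sup>+y. g y * indicator F y \<partial>?H))"
    by (subst nn_integral_multc) simp_all
  finally show ?thesis .
qed

text \<open>The choice \<open>\<delta> = c / (n + 2)\<close> makes the left-hand side exactly \<open>1\<close>.\<close>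
lemma nn_integral_radial_weight:
  fixes c :: real
  assumes c: "0 \<le> c" "c \<le> real n + 1" and n: "0 < n"
  shows "(\<integral>\<^sup>+s. ennreal (s ^ (n - 1)) * ennreal ((real n + 1 + c / (real n + 2) - c * (1 - s)) * s) *
    indicator {0..1} s \<partial>lborel) = 1"
proof -
  \<comment> \<open>The bracket is the linear polynomial \<open>A + c * s\<close>; the factor
    \<open>s\<close> outside it comes from the chord bound.\<close>
  define A where "A = real n + 1 + c / (real n + 2) - c"
  have A: "0 \<le> A"
  proof -
    have "0 \<le> c / (real n + 2)" using c by simp
    then show ?thesis unfolding A_def using c by linarith
  qed
  have "(\<integral>\<^sup>+s. ennreal (s ^ (n - 1)) * ennreal ((real n + 1 + c / (real n + 2) - c * (1 - s)) * s) *
    indicator {0..1} s \<partial>lborel) = (\<integral>\<^sup>+s. ennreal (A * s ^ n + c * s ^ (n + 1)) * indicator {0..1} s \<partial>lborel)"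
  proof (intro nn_integral_cong)
    fix s :: real
    have "s ^ (n - 1) * ((real n + 1 + c / (real n + 2) - c * (1 - s)) * s) = (A + c * s) * (s ^ (n - 1) * s)"
      by (simp add: A_def algebra_simps)
    \<comment> \<open>Subtraction is truncated, so this relies on \<open>0 < n\<close>.\<close>
    also have "s ^ (n - 1) * s = s ^ n" using n by (simp add: power_eq_if)
    finally have "s ^ (n - 1) * ((real n + 1 + c / (real n + 2) - c * (1 - s)) * s) = A * s ^ n + c * s ^ (n + 1)"
      by (simp add: algebra_simps)
    then show "ennreal (s ^ (n - 1)) * ennreal ((real n + 1 + c / (real n + 2) - c * (1 - s)) * s) *
        indicator {0..1} s = ennreal (A * s ^ n + c * s ^ (n + 1)) * indicator {0..1} s"
      by (auto simp: indicator_def ennreal_mult'[symmetric])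
  qed
  also have "\<dots> = ennreal ((\<lambda>s. A * s ^ (n + 1) / (real n + 1) + c * s ^ (n + 2) / (real n + 2)) 1 -
      (\<lambda>s. A * s ^ (n + 1) / (real n + 1) + c * s ^ (n + 2) / (real n + 2)) 0)"
  proof (rule nn_integral_FTC_Icc[where F="\<lambda>s. A * s ^ (n + 1) / (real n + 1) + c * s ^ (n + 2) / (real n + 2)"])
    fix x :: real assume x: "x \<in> {0..1}"
    show "((\<lambda>s. A * s ^ (n + 1) / (real n + 1) + c * s ^ (n + 2) / (real n + 2)) has_real_derivative
        A * x ^ n + c * x ^ (n + 1)) (at x)"
    proof -
      have nz: "real n + 1 \<noteq> 0" "real n + 2 \<noteq> 0" by linarith+
      have "((\<lambda>s. A * s ^ (n + 1) / (real n + 1) + c * s ^ (n + 2) / (real n + 2)) has_real_derivative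
          A * (real (n + 1) * x ^ n) / (real n + 1) + c * (real (n + 2) * x ^ (n + 1)) / (real n + 2)) (at x)"
        by (auto intro!: derivative_eq_intros simp del: power_Suc simp: ac_simps)
      moreover have "A * (real (n + 1) * x ^ n) / (real n + 1) = A * x ^ n"
        "c * (real (n + 2) * x ^ (n + 1)) / (real n + 2) = c * x ^ (n + 1)"
        using nz by (simp_all add: add.commute)
      ultimately show ?thesis by (simp only:)
    qed
    show "0 \<le> A * x ^ n + c * x ^ (n + 1)" using x A c by auto
  qed auto
  also have "(\<lambda>s. A * s ^ (n + 1) / (real n + 1) + c * s ^ (n + 2) / (real n + 2)) 1 -
      (\<lambda>s. A * s ^ (n + 1) / (real n + 1) + c * s ^ (n + 2) / (real n + 2)) 0 = 1"
  proof -
    have "A * (real n + 2) + c * (real n + 1) = (real n + 1) * (real n + 2)"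
      by (simp add: A_def field_simps)
    moreover have nz: "real n + 1 \<noteq> 0" "real n + 2 \<noteq> 0" by linarith+
    ultimately have "A / (real n + 1) + c / (real n + 2) = 1"
      unfolding add_frac_eq[OF nz] by (metis divide_self mult_eq_0_iff nz)
    then show ?thesis by simp
  qed
  finally show ?thesis by simp
qed

section \<open>Integration on a Delzant polytope\<close>

text \<open>The formula for measures of sets passes to integrals by induction over measurable
  functions; in the limit step the supremum is exchanged with the finite sum over the
  facets.\<close>

lemma nn_integral_boundary_measure:
  assumes "f \<in> borel_measurable borel"
  shows "(\<integral>\<^sup>+x. f x \<partial>boundary_measure r lam d) =
    (\<Sum>j=1..r. ennreal (1 / norm (of_int_vec (lam j))) *
      (\<integral>\<^sup>+x. f x * indicator (facet_set r lam d j) x \<partial>hyperplane_lborel (of_int_vec (lam j)) (real_of_int (d j))))"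
  using assms
proof (induction rule: borel_measurable_induct)
  case (cong f g)
  then show ?case by (simp cong: nn_integral_cong)
next
  case (set A)
  then show ?case by (simp add: emeasure_boundary_measure indicator_inter_arith[symmetric] facet_set_borel)
next
  case (mult u c)
  then show ?case
    by (simp add: nn_integral_cmult sum_distrib_left mult.assoc facet_set_borel mult.left_commute)
next
  case (add u v)
  then show ?case
    by (simp add: nn_integral_add distrib_left distrib_right sum.distrib facet_set_borel)
next
  case (seq U)
  let ?H = "\<lambda>j. hyperplane_lborel (of_int_vec (lam j)) (real_of_int (d j))"
  let ?F = "facet_set r lam d"
  note [measurable] = seq.hyps(1) facet_set_borel
  have [measurable]: "U i \<in> borel_measurable (?H j)" for i j using seq.hyps(1) by simp
  have inc: "incseq (\<lambda>i x. U i x * indicator (?F j) x)" for j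
    using seq.hyps(3) by (auto simp: incseq_def le_fun_def intro!: mult_right_mono)
  have S: "(SUP i. \<integral>\<^sup>+x. U i x * indicator (?F j) x \<partial>?H j) =
      (\<integral>\<^sup>+x. (SUP i. U i) x * indicator (?F j) x \<partial>?H j)" for j
    using nn_integral_monotone_convergence_SUP[OF inc[of j], of "?H j"]
    by (simp add: image_comp SUP_mult_right_ennreal)
  have "(\<integral>\<^sup>+x. (SUP i. U i) x \<partial>boundary_measure r lam d) = (SUP i. \<integral>\<^sup>+x. U i x \<partial>boundary_measure r lam d)"
    using nn_integral_monotone_convergence_SUP[OF seq.hyps(3), of "boundary_measure r lam d"] by (simp add: image_comp)
  also have "\<dots> = (SUP i. \<Sum>j=1..r. ennreal (1 / norm (of_int_vec (lam j))) * (\<integral>\<^sup>+x. U i x * indicator (?F j) x \<partial>?H j))"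
    by (simp add: seq.IH)
  also have "\<dots> = (\<Sum>j=1..r. SUP i. ennreal (1 / norm (of_int_vec (lam j))) * (\<integral>\<^sup>+x. U i x * indicator (?F j) x \<partial>?H j))"
    using inc by (intro ennreal_SUP_sum) (auto simp: incseq_def le_fun_def intro!: mult_left_mono nn_integral_mono)
  also have "\<dots> = (\<Sum>j=1..r. ennreal (1 / norm (of_int_vec (lam j))) * (\<integral>\<^sup>+x. (SUP i. U i) x * indicator (?F j) x \<partial>?H j))"
    by (simp add: SUP_mult_left_ennreal[symmetric] S)
  finally show ?case .
qed

text \<open>The measure is left general to serve Lebesgue measure on the polytope as well as the
  boundary measure on its frontier, and values may be vectors so that \<open>(x, 1)\<close> can be
  integrated.\<close>

lemma set_integrable_compact_continuous:
  fixes f :: "'a::euclidean_space \<Rightarrow> 'b::{banach, second_countable_topology}"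
  assumes K: "compact K" and f: "continuous_on K f" and M: "sets M = sets borel" "emeasure M K < \<infinity>"
  shows "set_integrable M K f"
proof -
  have Kb: "K \<in> sets borel" using K by (simp add: borel_closed compact_imp_closed)
  obtain B where B: "\<And>x. x \<in> K \<Longrightarrow> norm (f x) \<le> B"
    using compact_imp_bounded[OF compact_continuous_image[OF f K]] by (auto simp: bounded_iff)
  show ?thesis
    unfolding set_integrable_def
  proof (rule integrableI_bounded_set[where A=K and B=B])
    show "K \<in> sets M" using Kb M by simp
    show "(\<lambda>x. indicator K x *\<^sub>R f x) \<in> borel_measurable M"
      using borel_measurable_continuous_on_indicator[OF Kb f] M(1) by (simp cong: measurable_cong_sets)
  qed (use M B in auto)
qed

lemma affine_fns_segment:
  assumes "l \<in> affine_fns"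
  shows "l (x + u *\<^sub>R (y - x)) = (1 - u) * l x + u * l y"
  using assms by (auto simp: affine_fns_def inner_add_right inner_diff_right algebra_simps)

lemma continuous_on_Max_affine:
  fixes S :: "('a::euclidean_space \<times> real) set"
  assumes "finite S" "S \<noteq> {}"
  shows "continuous_on A (\<lambda>x. Max ((\<lambda>(a, c). a \<bullet> x + c) ` S))"
  using assms
proof (induction S rule: finite_ne_induct)
  case (singleton p)
  then show ?case by (auto simp: case_prod_beta intro!: continuous_intros)
next
  case (insert p S)
  then show ?case by (simp add: case_prod_beta) (intro continuous_intros)
qed

section \<open>Geometry and finite measures of the polytope and its facets\<close>

locale delzant_presentation =
  fixes r :: nat and lam :: "nat \<Rightarrow> int ^ 'n" and d :: "nat \<Rightarrow> int"
  assumes delzant: "integral_delzant r lam d"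
begin

abbreviation P :: "(real ^ 'n) set" where "P \<equiv> presented_polytope r lam d"
abbreviation F :: "nat \<Rightarrow> (real ^ 'n) set" where "F \<equiv> facet_set r lam d"
abbreviation \<sigma> :: "(real ^ 'n) measure" where "\<sigma> \<equiv> boundary_measure r lam d"
abbreviation BI :: "(real ^ 'n \<Rightarrow> real) \<Rightarrow> real" where "BI \<equiv> boundary_integral r lam d"
abbreviation PI :: "(real ^ 'n \<Rightarrow> real) \<Rightarrow> real" where "PI \<equiv> polytope_integral r lam d"
abbreviation s where "s \<equiv> s_bar r lam d"
abbreviation V where "V \<equiv> extremal_fn r lam d"

lemma compact_P: "compact P" and interior_P: "interior P \<noteq> {}"
  using delzant by (auto simp: integral_delzant_def Let_def polytope_imp_compact)

lemma P_borel [measurable]: "P \<in> sets borel" and frontier_borel [measurable]: "frontier P \<in> sets borel"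
  using compact_P by (auto simp: borel_closed compact_imp_closed)

lemma normal_nonzero:
  assumes "j \<in> {1..r}" shows "of_int_vec (lam j) \<noteq> 0"
proof
  assume "of_int_vec (lam j) = 0"
  then have "(\<lambda>i. lam j $ i) = (\<lambda>_. 0)" by (auto simp: of_int_vec_def vec_eq_iff)
  moreover have "primitive_vec (lam j)" using assms delzant by (simp add: integral_delzant_def Let_def)
  ultimately show False by (simp add: primitive_vec_def)
qed

lemma support_fn_pos_interior:
  assumes j: "j \<in> {1..r}" and x: "x \<in> interior P"
  shows "0 < support_fn lam d j x"
proof -
  let ?a = "of_int_vec (lam j)"
  obtain e where e: "e > 0" "ball x e \<subseteq> P" using x by (meson mem_interior)
  have a: "norm ?a > 0" using normal_nonzero[OF j] by simp
  \<comment> \<open>A step of length \<open>e / 2\<close> against the inner normal stays in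
    \<open>P\<close> but strictly lowers the defining function.\<close>
  define y where "y = x - (e / (2 * norm ?a)) *\<^sub>R ?a"
  have "dist x y = e / 2" using e(1) a by (simp add: y_def dist_norm)
  then have "y \<in> P" using e by auto
  then have "0 \<le> support_fn lam d j y" using j by (simp add: presented_polytope_def)
  moreover have "support_fn lam d j y = support_fn lam d j x - e / (2 * norm ?a) * (?a \<bullet> ?a)"
    by (simp add: y_def support_fn_def inner_diff_right)
  moreover have "e / (2 * norm ?a) * (?a \<bullet> ?a) > 0" using e(1) a by (intro mult_pos_pos) auto
  ultimately show ?thesis by linarith
qed

lemma facet_subset_frontier:
  assumes "j \<in> {1..r}" shows "F j \<subseteq> frontier P"
  using support_fn_pos_interior[OF assms] closure_subset[of P]
  by (force simp: frontier_def facet_set_def)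

text \<open>Without inequalities \<open>P\<close> would be the whole space, which is unbounded.
  Maxima over \<open>{1..r}\<close> are thereby maxima of nonempty sets.\<close>

lemma ex_facet: "1 \<le> r"
proof (rule ccontr)
  assume "\<not> 1 \<le> r"
  then have "P = UNIV" by (auto simp: presented_polytope_def)
  then show False using compact_P not_bounded_UNIV by (metis compact_imp_bounded)
qed

lemma boundary_measure_finite: "emeasure \<sigma> (frontier P) < \<infinity>"
proof -
  have "emeasure (hyperplane_lborel (of_int_vec (lam j)) (real_of_int (d j))) (frontier P \<inter> F j) < \<infinity>"
    if "j \<in> {1..r}" for j
  proof (rule emeasure_hyperplane_lborel_bounded[OF normal_nonzero[OF that]])
    show "bounded (frontier P \<inter> F j)"
      using compact_P by (meson bounded_Int compact_frontier compact_imp_bounded)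
    show "frontier P \<inter> F j \<in> sets borel" by (intro sets.Int frontier_borel facet_set_borel)
  qed
  then show ?thesis
    by (subst emeasure_boundary_measure) (auto simp: less_top[symmetric] ennreal_mult_eq_top_iff)
qed

lemma emeasure_P: "emeasure lborel P < \<infinity>"
  using emeasure_bounded_finite[OF compact_imp_bounded[OF compact_P]] by simp

lemma vol_pos: "0 < polytope_vol r lam d"
proof -
  have "P \<notin> null_sets lebesgue"
    using interior_P interior_subset[of P] open_interior[of P]
    by (metis negligible_iff_null_sets negligible_subset open_not_negligible)
  then have "emeasure lborel P \<noteq> 0" by (auto simp: null_sets_def)
  then show ?thesis
    using emeasure_P by (simp add: polytope_vol_def measure_def enn2real_positive_iff less_top zero_less_iff_neq_zero)
qed

lemma set_integrable_P:
  fixes f :: "real ^ 'n \<Rightarrow> 'b::{banach, second_countable_topology}"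
  assumes "continuous_on P f" shows "set_integrable lborel P f"
  using assms compact_P emeasure_P by (intro set_integrable_compact_continuous) auto

lemma set_integrable_frontier:
  fixes f :: "real ^ 'n \<Rightarrow> 'b::{banach, second_countable_topology}"
  assumes "continuous_on P f" shows "set_integrable \<sigma> (frontier P) f"
proof (rule set_integrable_compact_continuous)
  show "continuous_on (frontier P) f"
    using assms compact_P by (meson compact_imp_closed continuous_on_subset frontier_subset_closed)
qed (use compact_P boundary_measure_finite in \<open>auto simp: compact_frontier\<close>)

section \<open>Linearity and monotonicity of the boundary and volume integrals\<close>

lemma BI_add:
  assumes "continuous_on P f" "continuous_on P g"
  shows "BI (\<lambda>x. f x + g x) = BI f + BI g"
  using assms unfolding boundary_integral_def by (intro set_integral_add set_integrable_frontier)

lemma PI_add: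
  assumes "continuous_on P f" "continuous_on P g"
  shows "PI (\<lambda>x. f x + g x) = PI f + PI g"
  using assms unfolding polytope_integral_def by (intro set_integral_add set_integrable_P)

lemma PI_cmult: "PI (\<lambda>x. c * f x) = c * PI f"
  by (simp add: polytope_integral_def)

lemma BI_cong: "(\<And>x. x \<in> P \<Longrightarrow> f x = g x) \<Longrightarrow> BI f = BI g"
  unfolding boundary_integral_def set_lebesgue_integral_def
  using frontier_subset_closed[OF compact_imp_closed[OF compact_P]]
  by (intro Bochner_Integration.integral_cong) (auto simp: indicator_def)

lemma PI_cong: "(\<And>x. x \<in> P \<Longrightarrow> f x = g x) \<Longrightarrow> PI f = PI g"
  unfolding polytope_integral_def set_lebesgue_integral_def
  by (intro Bochner_Integration.integral_cong) (auto simp: indicator_def)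

lemma PI_mono:
  assumes "continuous_on P f" "continuous_on P g" "\<And>x. x \<in> P \<Longrightarrow> f x \<le> g x"
  shows "PI f \<le> PI g"
  using assms unfolding polytope_integral_def by (intro set_integral_mono set_integrable_P)

lemma PI_const: "PI (\<lambda>x. c) = c * polytope_vol r lam d"
  using emeasure_P by (simp add: polytope_integral_def polytope_vol_def set_lebesgue_integral_def)

lemma BI_const: "BI (\<lambda>x. c) = c * measure \<sigma> (frontier P)"
  using boundary_measure_finite by (simp add: boundary_integral_def set_lebesgue_integral_def)

section \<open>Affine functions and the extremal function\<close>

lemma affine_fns_continuous: "l \<in> affine_fns \<Longrightarrow> continuous_on S l"
  by (auto simp: affine_fns_def intro!: continuous_intros)

text \<open>This identifies affine functions with vectors of a Euclidean space, on which the Gram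
  operator becomes an endomorphism.\<close>

lemma affine_fns_pairing: "l \<in> affine_fns \<longleftrightarrow> (\<exists>p::(real ^ 'n) \<times> real. l = (\<lambda>x. p \<bullet> (x, 1)))"
  by (auto simp: affine_fns_def inner_prod_def fun_eq_iff)

text \<open>Positive definiteness of the Gram form: a nonzero affine function vanishes at most on a
  hyperplane, which is a null set, whereas \<open>P\<close> has positive volume.\<close>

lemma PI_square_pos:
  fixes p :: "(real ^ 'n) \<times> real"
  assumes "p \<noteq> 0" shows "0 < PI (\<lambda>x. (p \<bullet> (x, 1)) ^ 2)"
proof -
  have c: "continuous_on P (\<lambda>x. (p \<bullet> (x, 1)) ^ 2)" by (intro continuous_intros)
  have int: "integrable lborel (\<lambda>x. indicator P x *\<^sub>R (p \<bullet> (x, 1)) ^ 2)"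
    using set_integrable_P[OF c] by (simp add: set_integrable_def)
  have "PI (\<lambda>x. (p \<bullet> (x, 1)) ^ 2) \<noteq> 0"
  proof
    assume "PI (\<lambda>x. (p \<bullet> (x, 1)) ^ 2) = 0"
    then have "AE x in lborel. indicator P x *\<^sub>R (p \<bullet> (x, 1)) ^ 2 = 0"
      using integral_nonneg_eq_0_iff_AE[OF int] by (simp add: polytope_integral_def set_lebesgue_integral_def)
    \<comment> \<open>Negligibility refers to the completed measure, so the statement is moved
      there.\<close>
    then have "AE x in lebesgue. indicator P x *\<^sub>R (p \<bullet> (x, 1)) ^ 2 = 0"
      by (rule AE_completion)
    then have "AE x in lebesgue. x \<notin> P \<or> fst p \<bullet> x = - snd p"
      by eventually_elim (auto simp: inner_prod_def indicator_def)
    moreover have "AE x in lebesgue. fst p \<bullet> x \<noteq> - snd p"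
    proof -
      have "negligible {x. fst p \<bullet> x = - snd p}"
        using assms by (intro negligible_hyperplane) (auto simp: prod_eq_iff)
      then show ?thesis by (auto simp: negligible_iff_null_sets dest!: AE_not_in)
    qed
    ultimately have "AE x in lebesgue. x \<notin> P" by eventually_elim auto
    then have "P \<in> null_sets lebesgue"
      using AE_iff_null_sets[of P lebesgue] P_borel by simp
    then show False
      using vol_pos by (auto simp: polytope_vol_def null_sets_def measure_def)
  qed
  moreover have "0 \<le> PI (\<lambda>x. (p \<bullet> (x, 1)) ^ 2)"
    unfolding polytope_integral_def set_lebesgue_integral_def by (intro integral_nonneg_AE) auto
  ultimately show ?thesis by linarith
qed

text \<open>The Gram operator of the affine functions in \<open>L\<^sup>2(P)\<close> is injective, hence bijective.\<close>
lemma ex1_extremal: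
  "\<exists>!V. V \<in> affine_fns \<and> (\<forall>l\<in>affine_fns. BI l = PI (\<lambda>x. (s + V x) * l x))"
proof -
  let ?z = "\<lambda>x::real ^ 'n. (x, 1 :: real)"
  define M where "M p = (LINT x:P|lborel. (p \<bullet> ?z x) *\<^sub>R ?z x)" for p
  have iM: "set_integrable lborel P (\<lambda>x. (p \<bullet> ?z x) *\<^sub>R ?z x)" for p
    by (intro set_integrable_P continuous_intros)
  have iz: "set_integrable lborel P ?z" "set_integrable \<sigma> (frontier P) ?z"
    by (intro set_integrable_P set_integrable_frontier continuous_intros)+
  have inner: "q \<bullet> M p = PI (\<lambda>x. (p \<bullet> ?z x) * (q \<bullet> ?z x))" for p q
  proof -
    have "q \<bullet> M p = (\<integral>x. q \<bullet> (indicator P x *\<^sub>R (p \<bullet> ?z x) *\<^sub>R ?z x) \<partial>lborel)"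
      unfolding M_def set_lebesgue_integral_def
      by (rule integral_inner_right[symmetric]) (use iM in \<open>auto simp: set_integrable_def\<close>)
    then show ?thesis
      by (simp only: polytope_integral_def set_lebesgue_integral_def inner_scaleR_right real_scaleR_def)
  qed
  have lin: "linear M"
  proof (rule linearI)
    show "M (p + q) = M p + M q" for p q
      unfolding M_def using set_integral_add(2)[OF iM[of p] iM[of q]]
      by (simp only: inner_add_left scaleR_add_left)
    show "M (c *\<^sub>R p) = c *\<^sub>R M p" for c p
      unfolding M_def by (simp only: inner_scaleR_left scaleR_scaleR[symmetric] set_integral_scaleR_right)
  qed
  have ker: "p = 0" if "M p = 0" for p
    using PI_square_pos[of p] inner[of p p] that by (auto simp: power2_eq_square)
  have "inj M" using lin ker by (metis linear_injective_0)
  then have surj: "surj M" using lin by (metis linear_injective_imp_surjective)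
  \<comment> \<open>Chosen so that \<open>q \<bullet> b\<close> is the boundary integral minus
    \<open>s\<close> times the volume integral of the affine function with coefficients
    \<open>q\<close>. The condition characterizing the extremal function then reads
    \<open>M p = b\<close>.\<close>
  define b where "b = (LINT x:frontier P|\<sigma>. ?z x) - s *\<^sub>R (LINT x:P|lborel. ?z x)"
  have b: "BI (\<lambda>x. q \<bullet> ?z x) = s * PI (\<lambda>x. q \<bullet> ?z x) + q \<bullet> b" for q
  proof -
    have "q \<bullet> (LINT x:frontier P|\<sigma>. ?z x) = BI (\<lambda>x. q \<bullet> ?z x)"
      using integral_inner_right[OF iz(2)[unfolded set_integrable_def], of q]
      by (simp only: set_lebesgue_integral_def boundary_integral_def inner_scaleR_right real_scaleR_def)
    moreover have "q \<bullet> (LINT x:P|lborel. ?z x) = PI (\<lambda>x. q \<bullet> ?z x)"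
      using integral_inner_right[OF iz(1)[unfolded set_integrable_def], of q]
      by (simp only: set_lebesgue_integral_def polytope_integral_def inner_scaleR_right real_scaleR_def)
    ultimately show ?thesis by (simp add: b_def inner_diff_right)
  qed
  have PI: "PI (\<lambda>x. (s + p \<bullet> ?z x) * (q \<bullet> ?z x)) = s * PI (\<lambda>x. q \<bullet> ?z x) + q \<bullet> M p" for p q
  proof -
    have "PI (\<lambda>x. s * (q \<bullet> ?z x) + (p \<bullet> ?z x) * (q \<bullet> ?z x)) =
        PI (\<lambda>x. s * (q \<bullet> ?z x)) + PI (\<lambda>x. (p \<bullet> ?z x) * (q \<bullet> ?z x))"
      by (intro PI_add continuous_intros)
    then show ?thesis by (simp only: distrib_right inner PI_cmult)
  qed
  have char: "(\<forall>l\<in>affine_fns. BI l = PI (\<lambda>x. (s + p \<bullet> ?z x) * l x)) \<longleftrightarrow> M p = b" for p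
  proof -
    have "(\<forall>l\<in>affine_fns. BI l = PI (\<lambda>x. (s + p \<bullet> ?z x) * l x)) \<longleftrightarrow>
        (\<forall>q. BI (\<lambda>x. q \<bullet> ?z x) = PI (\<lambda>x. (s + p \<bullet> ?z x) * (q \<bullet> ?z x)))"
    proof (intro iffI allI ballI)
      fix q assume H: "\<forall>l\<in>affine_fns. BI l = PI (\<lambda>x. (s + p \<bullet> ?z x) * l x)"
      have "(\<lambda>x. q \<bullet> ?z x) \<in> affine_fns" unfolding affine_fns_pairing by (rule exI[of _ q]) (rule refl)
      with H show "BI (\<lambda>x. q \<bullet> ?z x) = PI (\<lambda>x. (s + p \<bullet> ?z x) * (q \<bullet> ?z x))" by (rule bspec)
    next
      fix l :: "real ^ 'n \<Rightarrow> real"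
      assume H: "\<forall>q. BI (\<lambda>x. q \<bullet> ?z x) = PI (\<lambda>x. (s + p \<bullet> ?z x) * (q \<bullet> ?z x))" and "l \<in> affine_fns"
      then obtain q where q: "l = (\<lambda>x. q \<bullet> ?z x)" unfolding affine_fns_pairing by (elim exE)
      show "BI l = PI (\<lambda>x. (s + p \<bullet> ?z x) * l x)" unfolding q by (rule H[rule_format])
    qed
    also have "\<dots> \<longleftrightarrow> (\<forall>q. q \<bullet> b = q \<bullet> M p)"
      by (simp only: b PI add_left_cancel)
    also have "\<dots> \<longleftrightarrow> b = M p" by (rule vector_eq_ldot)
    finally show ?thesis by (simp only: eq_commute[of b])
  qed
  obtain p where p: "M p = b" using surj by (metis surjD)
  show ?thesis
  proof (rule ex1I[of _ "\<lambda>x. p \<bullet> ?z x"])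
    show "(\<lambda>x. p \<bullet> ?z x) \<in> affine_fns \<and> (\<forall>l\<in>affine_fns. BI l = PI (\<lambda>x. (s + p \<bullet> ?z x) * l x))"
      using char p unfolding affine_fns_pairing by blast
  next
    fix W assume W: "W \<in> affine_fns \<and> (\<forall>l\<in>affine_fns. BI l = PI (\<lambda>x. (s + W x) * l x))"
    then obtain q where q: "W = (\<lambda>x. q \<bullet> ?z x)" by (auto simp: affine_fns_pairing)
    have "M q = b" using W char[of q] by (simp add: q)
    then have "q = p" using p \<open>inj M\<close> by (metis injD)
    then show "W = (\<lambda>x. p \<bullet> ?z x)" by (simp add: q)
  qed
qed

lemma extremal_affine: "V \<in> affine_fns"
  and extremal_eq: "l \<in> affine_fns \<Longrightarrow> BI l = PI (\<lambda>x. (s + V x) * l x)"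
  using theI'[OF ex1_extremal] unfolding extremal_fn_def by auto

text \<open>The characterization of \<open>V\<close> says that \<open>L_V\<close> vanishes on affine
  functions. This permits subtracting a supporting affine function at \<open>x0\<close>.\<close>

lemma L_V_add_affine:
  assumes f: "continuous_on P f" and l: "l \<in> affine_fns"
  shows "L_V r lam d (\<lambda>x. f x + l x) = L_V r lam d f"
proof -
  note [continuous_intros] = affine_fns_continuous[OF l] affine_fns_continuous[OF extremal_affine] f
  have "PI (\<lambda>x. (s + V x) * f x + (s + V x) * l x) = PI (\<lambda>x. (s + V x) * f x) + PI (\<lambda>x. (s + V x) * l x)"
    by (intro PI_add continuous_intros)
  moreover have "BI (\<lambda>x. f x + l x) = BI f + BI l" by (intro BI_add continuous_intros)
  ultimately show ?thesis using extremal_eq[OF l] by (simp add: L_V_def distrib_left)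
qed

text \<open>Testing the characterization of \<open>V\<close> with the function \<open>1\<close>
  equates \<open>s\<close> and \<open>s + c\<close>, because \<open>s\<close> is boundary mass
  divided by volume. This excludes the borderline case where a nonzero \<open>V\<close> attains the
  assumed upper bound throughout \<open>P\<close>.\<close>

lemma extremal_const_zero:
  assumes "\<And>x. x \<in> P \<Longrightarrow> V x = c" shows "c = 0"
proof -
  have "(\<lambda>x::real ^ 'n. 1::real) = (\<lambda>x. 0 \<bullet> x + 1)" by simp
  then have "(\<lambda>x::real ^ 'n. 1::real) \<in> affine_fns" unfolding affine_fns_def by blast
  then have "BI (\<lambda>x. 1) = PI (\<lambda>x. (s + V x) * 1)"
    by (rule extremal_eq)
  also have "\<dots> = PI (\<lambda>x. s + c)" by (rule PI_cong) (simp add: assms)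
  finally have "measure \<sigma> (frontier P) = (s + c) * polytope_vol r lam d"
    by (simp only: PI_const BI_const)
  then show ?thesis using vol_pos by (simp add: s_bar_def field_simps)
qed

section \<open>The stability estimate\<close>

text \<open>The number \<open>t j\<close> is the relative loss of the \<open>j\<close>-th defining
  function from \<open>x0\<close> to \<open>x\<close>. The ray from \<open>x0\<close> through
  \<open>x\<close> leaves \<open>P\<close> where the fastest loser reaches zero, so an index with
  maximal \<open>t j\<close> gives the exit facet.\<close>

lemma cone_over_facet:
  assumes x0: "x0 \<in> interior P" and x: "x \<in> P" "x \<noteq> x0"
  defines "D \<equiv> \<lambda>j. support_fn lam d j x0"
  defines "t \<equiv> \<lambda>j. (D j - support_fn lam d j x) / D j"
  obtains j where "j \<in> {1..r}" "0 < t j" "t j \<le> 1" "x0 + (1 / t j) *\<^sub>R (x - x0) \<in> F j"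
proof -
  have D: "0 < D j" if "j \<in> {1..r}" for j
    unfolding D_def using support_fn_pos_interior[OF that x0] .
  have ne: "{1..r} \<noteq> {}" using ex_facet by auto
  define T where "T = Max (t ` {1..r})"
  have T: "t j \<le> T" if "j \<in> {1..r}" for j using that by (simp add: T_def)
  have "T \<in> t ` {1..r}" unfolding T_def by (rule Max_in) (use ne in auto)
  then obtain j where j: "j \<in> {1..r}" "t j = T" by blast
  have supp: "support_fn lam d i (x0 + u *\<^sub>R (x - x0)) = D i * (1 - u * t i)" if "i \<in> {1..r}" for i u
  proof -
    have "support_fn lam d i (x0 + u *\<^sub>R (x - x0)) = D i - u * (D i - support_fn lam d i x)"
      by (simp add: D_def support_fn_def inner_add_right inner_diff_right algebra_simps)
    also have "D i - support_fn lam d i x = D i * t i" using D[OF that] by (simp add: t_def)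
    finally show ?thesis by (simp add: algebra_simps)
  qed
  \<comment> \<open>If no defining function decreased, the whole ray would stay in the bounded set
    \<open>P\<close>.\<close>
  have "0 < T"
  proof (rule ccontr)
    assume "\<not> 0 < T"
    then have le: "t i \<le> 0" if "i \<in> {1..r}" for i using T[OF that] by simp
    have ray: "x0 + u *\<^sub>R (x - x0) \<in> P" if "0 \<le> u" for u
      unfolding presented_polytope_def
    proof (intro CollectI ballI)
      fix i assume i: "i \<in> {1..r}"
      have "u * t i \<le> 0" using le[OF i] that by (simp add: mult_nonneg_nonpos)
      then show "0 \<le> support_fn lam d i (x0 + u *\<^sub>R (x - x0))"
        unfolding supp[OF i] using D[OF i] by simp
    qed
    obtain B where B: "\<And>y. y \<in> P \<Longrightarrow> norm y \<le> B"
      using compact_imp_bounded[OF compact_P] by (auto simp: bounded_iff)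
    have B0: "0 \<le> B" using B[OF x(1)] norm_ge_zero[of x] by linarith
    have nz: "0 < norm (x - x0)" using x(2) by simp
    \<comment> \<open>The displacement gets length \<open>B + norm x0 + 1\<close>, enough to leave
      the ball of radius \<open>B\<close> around the origin.\<close>
    define u where "u = (B + norm x0 + 1) / norm (x - x0)"
    have u: "0 \<le> u" "u * norm (x - x0) = B + norm x0 + 1" using nz B0 by (auto simp: u_def)
    have "norm (u *\<^sub>R (x - x0)) \<le> norm (x0 + u *\<^sub>R (x - x0)) + norm x0"
      using norm_triangle_ineq4[of "x0 + u *\<^sub>R (x - x0)" x0] by simp
    then show False using B[OF ray[OF u(1)]] u by simp
  qed
  moreover have "T \<le> 1"
    using j D[OF j(1)] x(1) by (auto simp: t_def presented_polytope_def divide_le_eq)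
  moreover have "x0 + (1 / T) *\<^sub>R (x - x0) \<in> F j"
    unfolding facet_set_def presented_polytope_def
  proof (intro CollectI conjI ballI)
    fix i assume i: "i \<in> {1..r}"
    have "(1 / T) * t i \<le> 1" using T[OF i] \<open>0 < T\<close> by (simp add: field_simps)
    then show "0 \<le> support_fn lam d i (x0 + (1 / T) *\<^sub>R (x - x0))"
      unfolding supp[OF i] using D[OF i] by simp
  next
    show "support_fn lam d j (x0 + (1 / T) *\<^sub>R (x - x0)) = 0"
      unfolding supp[OF j(1)] using j(2) \<open>0 < T\<close> by simp
  qed
  ultimately show thesis using j that[of j] by simp
qed

text \<open>Decompose \<open>P\<close> into the cones with apex \<open>x0\<close> over the facets; on a ray \<open>f\<close> is bounded by the
  chord from its zero at \<open>x0\<close>.\<close>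
lemma weighted_integral_le_boundary:
  fixes c :: real and w f :: "real ^ 'n \<Rightarrow> real"
  assumes x0: "x0 \<in> interior P"
    and D: "\<And>j. j \<in> {1..r} \<Longrightarrow> support_fn lam d j x0 \<le> D"
    and c: "0 \<le> c" "c \<le> real CARD('n) + 1"
    and w: "continuous_on UNIV w"
    and wle: "\<And>y u. y \<in> P \<Longrightarrow> 0 < u \<Longrightarrow> u \<le> 1 \<Longrightarrow>
      w (x0 + u *\<^sub>R (y - x0)) \<le> real CARD('n) + 1 + c / (real CARD('n) + 2) - c * (1 - u)"
    and f: "continuous_on UNIV f" "\<And>x. 0 \<le> f x" "f x0 = 0"
    and fle: "\<And>y u. y \<in> P \<Longrightarrow> 0 < u \<Longrightarrow> u \<le> 1 \<Longrightarrow> f (x0 + u *\<^sub>R (y - x0)) \<le> u * f y"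
  shows "PI (\<lambda>x. w x * f x) \<le> D * BI f"
proof -
  let ?n = "real CARD('n)"
  have n: "DIM(real ^ 'n) = CARD('n)" by simp
  have [measurable]: "w \<in> borel_measurable borel" "f \<in> borel_measurable borel"
    using w f by (auto intro: borel_measurable_continuous_onI)
  \<comment> \<open>The weight may be negative; its positive part makes extended nonnegative
    integrals applicable and still bounds \<open>w x * f x\<close> from above.\<close>
  define G where "G x = ennreal (max 0 (w x) * f x)" for x
  have [measurable]: "G \<in> borel_measurable borel" unfolding G_def by measurable
  \<comment> \<open>The bound on the weight at radius \<open>u\<close> times the chord factor
    \<open>u\<close>; against \<open>u ^ (n - 1)\<close> it integrates to \<open>1\<close>.\<close>
  define k where "k u = ennreal ((?n + 1 + c / (?n + 2) - c * (1 - u)) * u)" for u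
  have [measurable]: "k \<in> borel_measurable borel" unfolding k_def by measurable
  define g where "g = (\<lambda>x. ennreal (f x))"
  have [measurable]: "g \<in> borel_measurable borel" unfolding g_def by measurable
  define dx where "dx j = support_fn lam d j x0" for j
  have dx: "0 < dx j" if "j \<in> {1..r}" for j
    using support_fn_pos_interior[OF that x0] by (simp add: dx_def)
  have D0: "0 \<le> D" using D[of 1] dx[of 1] ex_facet by (simp add: dx_def)
  define t where "t j x = (dx j - (of_int_vec (lam j) \<bullet> x + real_of_int (d j))) / dx j" for j x
  define K where "K j = {x. 0 < t j x \<and> t j x \<le> 1 \<and> x0 + (1 / t j x) *\<^sub>R (x - x0) \<in> F j}" for j
  have [measurable]: "K j \<in> sets borel" for j
    unfolding K_def t_def using facet_set_borel[of r lam d j] by measurable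
  let ?H = "\<lambda>j. hyperplane_lborel (of_int_vec (lam j)) (real_of_int (d j))"
  let ?N = "\<lambda>j. norm (of_int_vec (lam j) :: real ^ 'n)"
  have Gle: "G (x0 + u *\<^sub>R (y - x0)) \<le> k u * g y" if "y \<in> P" "0 < u" "u \<le> 1" for y u
  proof -
    let ?x = "x0 + u *\<^sub>R (y - x0)"
    let ?m = "?n + 1 + c / (?n + 2) - c * (1 - u)"
    have "c * (1 - u) \<le> c * 1" using c(1) that by (intro mult_left_mono) auto
    moreover have "0 \<le> c / (?n + 2)" using c(1) by simp
    ultimately have m: "0 \<le> ?m" using c(2) by linarith
    have "max 0 (w ?x) * f ?x \<le> ?m * (u * f y)"
      using wle[OF that] fle[OF that] m f(2) by (intro mult_mono) auto
    then have "G ?x \<le> ennreal (?m * (u * f y))" unfolding G_def by (rule ennreal_leI)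
    also have "\<dots> = k u * g y"
      unfolding k_def g_def using m that f(2)[of y] by (simp add: ennreal_mult[symmetric] mult.assoc)
    finally show ?thesis .
  qed
  have cone: "(\<integral>\<^sup>+x. G x * indicator (K j) x \<partial>lborel) \<le>
      ennreal (dx j / ?N j) * (\<integral>\<^sup>+y. g y * indicator (F j) y \<partial>?H j)" if j: "j \<in> {1..r}" for j
  proof -
    have "(\<integral>\<^sup>+x. G x * indicator (K j) x \<partial>lborel) \<le> ennreal (dx j / ?N j) *
      ((\<integral>\<^sup>+u. ennreal (u ^ (DIM(real ^ 'n) - 1)) * k u * indicator {0..1} u \<partial>lborel) *
        (\<integral>\<^sup>+y. g y * indicator (F j) y \<partial>?H j))"
      unfolding K_def t_def
    proof (rule nn_integral_cone_le)
      show "dx j = of_int_vec (lam j) \<bullet> x0 + real_of_int (d j)" by (simp add: dx_def support_fn_def)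
    qed (use Gle normal_nonzero[OF j] dx[OF j] facet_set_borel in \<open>auto simp: facet_set_def\<close>)
    also have "(\<integral>\<^sup>+u. ennreal (u ^ (DIM(real ^ 'n) - 1)) * k u * indicator {0..1} u \<partial>lborel) = 1"
      unfolding k_def n by (rule nn_integral_radial_weight[OF c]) simp
    finally show ?thesis by simp
  qed
  \<comment> \<open>Cones may overlap, so the covering gives an inequality, in the direction wanted.
    The apex lies in no cone, but \<open>f\<close> vanishes there.\<close>
  have "(\<integral>\<^sup>+x. G x * indicator P x \<partial>lborel) \<le> (\<integral>\<^sup>+x. (\<Sum>j=1..r. G x * indicator (K j) x) \<partial>lborel)"
  proof (rule nn_integral_mono)
    fix x
    show "G x * indicator P x \<le> (\<Sum>j=1..r. G x * indicator (K j) x)"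
    proof (cases "x \<in> P \<and> x \<noteq> x0")
      case True
      then obtain j where "j \<in> {1..r}" "x \<in> K j"
        using cone_over_facet[OF x0, of x] by (auto simp: K_def t_def dx_def support_fn_def)
      then have "G x * indicator (K j) x \<le> (\<Sum>j=1..r. G x * indicator (K j) x)"
        by (intro member_le_sum) auto
      then show ?thesis using True \<open>x \<in> K j\<close> by simp
    next
      case False
      then show ?thesis using f(3) by (auto simp: G_def)
    qed
  qed
  also have "\<dots> = (\<Sum>j=1..r. \<integral>\<^sup>+x. G x * indicator (K j) x \<partial>lborel)"
    by (rule nn_integral_sum) simp
  also have "\<dots> \<le> (\<Sum>j=1..r. ennreal (dx j / ?N j) * (\<integral>\<^sup>+y. g y * indicator (F j) y \<partial>?H j))"
    by (intro sum_mono cone)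
  \<comment> \<open>Each \<open>dx j\<close> is replaced by its bound \<open>D\<close>, and
    \<open>1 / ?N j\<close> is the density in the boundary measure. The indicator of the frontier
    equals \<open>1\<close> on every facet.\<close>
  also have "\<dots> \<le> (\<Sum>j=1..r. ennreal D * (ennreal (1 / ?N j) *
      (\<integral>\<^sup>+y. (g y * indicator (frontier P) y) * indicator (F j) y \<partial>?H j)))"
  proof (rule sum_mono)
    fix j assume j: "j \<in> {1..r}"
    have "(\<integral>\<^sup>+y. g y * indicator (F j) y \<partial>?H j) =
        (\<integral>\<^sup>+y. (g y * indicator (frontier P) y) * indicator (F j) y \<partial>?H j)"
      using facet_subset_frontier[OF j] by (intro nn_integral_cong) (auto simp: indicator_def)
    moreover have "ennreal (dx j / ?N j) \<le> ennreal D * ennreal (1 / ?N j)"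
      using D[OF j] D0 by (subst ennreal_mult[symmetric]) (auto simp: dx_def intro!: ennreal_leI divide_right_mono)
    ultimately show "ennreal (dx j / ?N j) * (\<integral>\<^sup>+y. g y * indicator (F j) y \<partial>?H j) \<le> ennreal D *
      (ennreal (1 / ?N j) * (\<integral>\<^sup>+y. (g y * indicator (frontier P) y) * indicator (F j) y \<partial>?H j))"
      by (simp only: mult.assoc[symmetric] mult_right_mono zero_le)
  qed
  also have "\<dots> = ennreal D * (\<integral>\<^sup>+y. g y * indicator (frontier P) y \<partial>\<sigma>)"
    by (subst nn_integral_boundary_measure) (simp_all add: sum_distrib_left)
  also have "(\<integral>\<^sup>+y. g y * indicator (frontier P) y \<partial>\<sigma>) = ennreal (BI f)"
  proof -
    have "integrable \<sigma> (\<lambda>x. indicator (frontier P) x *\<^sub>R f x)"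
      using set_integrable_frontier[of f] f(1) by (simp add: set_integrable_def continuous_on_subset)
    then have "(\<integral>\<^sup>+x. ennreal (indicator (frontier P) x *\<^sub>R f x) \<partial>\<sigma>) = ennreal (BI f)"
      unfolding boundary_integral_def set_lebesgue_integral_def
      by (rule nn_integral_eq_integral) (use f(2) in auto)
    moreover have "g y * indicator (frontier P) y = ennreal (indicator (frontier P) y *\<^sub>R f y)" for y
      by (auto simp: g_def indicator_def)
    ultimately show ?thesis by simp
  qed
  finally have le: "(\<integral>\<^sup>+x. G x * indicator P x \<partial>lborel) \<le> ennreal D * ennreal (BI f)" .
  have BI: "0 \<le> BI f" unfolding boundary_integral_def set_lebesgue_integral_def
    by (intro integral_nonneg_AE) (use f(2) in auto)
  show ?thesis
    unfolding polytope_integral_def set_lebesgue_integral_def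
  proof (rule integral_real_bounded)
    show "0 \<le> D * BI f" using D0 BI by simp
    have "(\<integral>\<^sup>+x. ennreal (indicator P x *\<^sub>R (w x * f x)) \<partial>lborel) \<le> (\<integral>\<^sup>+x. G x * indicator P x \<partial>lborel)"
      by (intro nn_integral_mono)
        (auto simp: G_def indicator_def f(2) intro!: ennreal_leI mult_right_mono)
    also have "\<dots> \<le> ennreal (D * BI f)" using le D0 BI by (simp add: ennreal_mult)
    finally show "(\<integral>\<^sup>+x. ennreal (indicator P x *\<^sub>R (w x * f x)) \<partial>lborel) \<le> ennreal (D * BI f)" .
  qed
qed

section \<open>Comparison with the J-norm\<close>

lemma J_norm_le:
  assumes f: "continuous_on P f" and \<xi>: "\<xi> \<in> affine_fns"
    and pos: "\<And>x. x \<in> P \<Longrightarrow> 0 \<le> f x + \<xi> x"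
  shows "J_norm r lam d f \<le> PI (\<lambda>x. f x + \<xi> x) / polytope_vol r lam d"
proof -
  define v where "v = polytope_vol r lam d"
  have v: "0 < v" unfolding v_def by (rule vol_pos)
  have ne: "P \<noteq> {}" using interior_P interior_subset[of P] by auto
  let ?J = "\<lambda>\<xi>. 1 / v * PI (\<lambda>x. f x + \<xi> x) - (INF x\<in>P. f x + \<xi> x)"
  \<comment> \<open>A mean value is at least the infimum. This lower bound ensures that the real
    infimum in \<open>J_norm\<close> lies below each of its members.\<close>
  have nonneg: "0 \<le> ?J l" if "l \<in> affine_fns" for l
  proof -
    have c: "continuous_on P (\<lambda>x. f x + l x)"
      using f affine_fns_continuous[OF that] by (intro continuous_intros)
    have "bdd_below ((\<lambda>x. f x + l x) ` P)"
      using compact_continuous_image[OF c compact_P] by (intro bounded_imp_bdd_below compact_imp_bounded)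
    then have "PI (\<lambda>x. INF x\<in>P. f x + l x) \<le> PI (\<lambda>x. f x + l x)"
      by (intro PI_mono c continuous_intros cINF_lower)
    then show ?thesis using v by (simp add: PI_const v_def field_simps)
  qed
  have "J_norm r lam d f \<le> ?J \<xi>"
    unfolding J_norm_def v_def[symmetric]
    by (rule cINF_lower[OF bdd_belowI2[OF nonneg] \<xi>])
  moreover have "0 \<le> (INF x\<in>P. f x + \<xi> x)" by (rule cINF_greatest[OF ne pos])
  ultimately show ?thesis by (simp add: v_def)
qed

lemma J_norm_cong: "(\<And>x. x \<in> P \<Longrightarrow> f x = g x) \<Longrightarrow> J_norm r lam d f = J_norm r lam d g"
  unfolding J_norm_def by (intro INF_cong refl arg_cong2[where f="(-)"] arg_cong2[where f="(*)"] PI_cong) auto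

lemma L_V_cong: "(\<And>x. x \<in> P \<Longrightarrow> f x = g x) \<Longrightarrow> L_V r lam d f = L_V r lam d g"
  unfolding L_V_def by (intro arg_cong2[where f="(-)"] BI_cong PI_cong) auto

text \<open>A minimum principle: a positive value at \<open>x\<close> would force a negative one on
  the opposite side of \<open>x0\<close>, where nearby points still belong to
  \<open>P\<close>.\<close>

lemma affine_nonneg_zero_interior:
  assumes h: "h \<in> affine_fns" "\<And>x. x \<in> P \<Longrightarrow> 0 \<le> h x"
    and x0: "x0 \<in> interior P" "h x0 = 0" and x: "x \<in> P"
  shows "h x = 0"
proof (cases "x = x0")
  case False
  obtain e where e: "e > 0" "ball x0 e \<subseteq> P" using x0(1) by (meson mem_interior)
  define u where "u = e / (2 * norm (x - x0))"
  have u: "0 < u" using e False by (simp add: u_def)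
  have "norm (u *\<^sub>R (x - x0)) = e / 2" using False e by (simp add: u_def)
  then have "x0 + (- u) *\<^sub>R (x - x0) \<in> P" using e by (intro subsetD[OF e(2)]) (simp add: dist_norm)
  then have "0 \<le> h (x0 + (- u) *\<^sub>R (x - x0))" by (rule h(2))
  then have "u * h x \<le> 0" unfolding affine_fns_segment[OF h(1)] x0(2) by simp
  then show ?thesis using u h(2)[OF x] by (simp add: mult_le_0_iff)
qed (simp add: x0)

lemma uniform_stability:
  assumes x0: "x0 \<in> interior P"
    and D: "D = Max ((\<lambda>j. support_fn lam d j x0) ` {1..r})"
    and hyp: "(\<forall>x\<in>P. V x = 0) \<and> s < (real CARD('n) + 1) / D \<or>
         \<not> (\<forall>x\<in>P. V x = 0) \<and> s + (SUP x\<in>P. V x) \<le> (real CARD('n) + 1) / D"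
  shows "uniformly_relatively_K_polystable r lam d"
proof -
  let ?n = "real CARD('n)"
  have x0P: "x0 \<in> P" using x0 interior_subset by auto
  have Dge: "support_fn lam d j x0 \<le> D" if "j \<in> {1..r}" for j using that by (simp add: D)
  have D0: "0 < D"
    using Dge[of 1] support_fn_pos_interior[of 1, OF _ x0] ex_facet by force
  define h where "h x = ?n + 1 - D * (s + V x)" for x
  obtain a b where V: "V = (\<lambda>x. a \<bullet> x + b)" using extremal_affine by (auto simp: affine_fns_def)
  have "h = (\<lambda>x. (- D *\<^sub>R a) \<bullet> x + (?n + 1 - D * s - D * b))"
    by (auto simp: h_def V algebra_simps)
  then have h_aff: "h \<in> affine_fns" unfolding affine_fns_def by blast
  have h_nonneg: "0 \<le> h x" if "x \<in> P" for x
  proof -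
    have "s + V x \<le> (?n + 1) / D"
    proof (cases "\<forall>x\<in>P. V x = 0")
      case True
      then show ?thesis using hyp that by force
    next
      case False
      have "bdd_above (V ` P)"
        using compact_continuous_image[OF affine_fns_continuous[OF extremal_affine] compact_P]
        by (intro bounded_imp_bdd_above compact_imp_bounded)
      then have "V x \<le> (SUP x\<in>P. V x)" using that by (rule cSUP_upper[rotated])
      then show ?thesis using False hyp by linarith
    qed
    then show ?thesis using D0 by (simp add: h_def field_simps)
  qed
  \<comment> \<open>If \<open>V\<close> vanishes on \<open>P\<close>, the assumed inequality is
    strict. Otherwise a zero of \<open>h\<close> at the interior point \<open>x0\<close> would make
    \<open>h\<close> vanish on \<open>P\<close>, so \<open>V\<close> would be constant there and
    hence zero.\<close>
  have h_pos: "0 < h x0"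
  proof (cases "\<forall>x\<in>P. V x = 0")
    case True
    then show ?thesis using hyp x0P D0 by (auto simp: h_def field_simps)
  next
    case False
    have "h x0 \<noteq> 0"
    proof
      assume "h x0 = 0"
      then have "h x = 0" if "x \<in> P" for x
        using affine_nonneg_zero_interior[OF h_aff h_nonneg x0 _ that] by simp
      then have const: "V x = (?n + 1) / D - s" if "x \<in> P" for x
        using that D0 by (auto simp: h_def field_simps)
      then show False using False extremal_const_zero by metis
    qed
    then show ?thesis using h_nonneg[OF x0P] by simp
  qed
  \<comment> \<open>The bound by \<open>h x0\<close> gives the gain \<open>c * (1 - u)\<close> along
    rays, and the cap \<open>?n + 1\<close> keeps the bound on the weight nonnegative.\<close>
  define c where "c = min (h x0) (?n + 1)"
  have c: "0 < c" "c \<le> ?n + 1" "c \<le> h x0" using h_pos by (auto simp: c_def)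
  define \<delta> where "\<delta> = c / (?n + 2)"
  have \<delta>: "0 < \<delta>" using c(1) by (simp add: \<delta>_def)
  \<comment> \<open>This equals \<open>D * (s + V x) + \<delta>\<close>; the surplus
    \<open>\<delta>\<close> is what makes the final estimate uniform.\<close>
  define w where "w x = ?n + 1 + \<delta> - h x" for x
  have V_cont: "continuous_on A V" for A by (rule affine_fns_continuous[OF extremal_affine])
  have w_cont: "continuous_on A w" for A
    unfolding w_def by (intro continuous_intros affine_fns_continuous[OF h_aff])
  have w_eq: "w x = D * (s + V x) + \<delta>" for x by (simp add: w_def h_def)
  \<comment> \<open>Along a ray \<open>h\<close> interpolates between \<open>h x0\<close> and
    \<open>h y\<close>, and \<open>h y\<close> is nonnegative.\<close>
  have w_le: "w (x0 + u *\<^sub>R (y - x0)) \<le> ?n + 1 + c / (?n + 2) - c * (1 - u)"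
    if "y \<in> P" "0 < u" "u \<le> 1" for y u
  proof -
    have "c * (1 - u) \<le> (1 - u) * h x0" using mult_right_mono[OF c(3), of "1 - u"] that by (simp add: mult.commute)
    moreover have "0 \<le> u * h y" using h_nonneg[OF that(1)] that by simp
    ultimately show ?thesis unfolding w_def affine_fns_segment[OF h_aff] \<delta>_def by linarith
  qed
  show ?thesis
    unfolding uniformly_relatively_K_polystable_def
  proof (intro exI conjI ballI)
    \<comment> \<open>The volume enters through the mean value bounding the J-norm, and
      \<open>D\<close> through the boundary estimate.\<close>
    show "0 < \<delta> * polytope_vol r lam d / D" using \<delta> vol_pos D0 by simp
    fix f assume "f \<in> rational_PL_convex r lam d"
    then obtain S :: "((real ^ 'n) \<times> real) set" where S: "finite S" "S \<noteq> {}"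
      and fS: "\<And>x. x \<in> P \<Longrightarrow> f x = Max ((\<lambda>(a, c). a \<bullet> x + c) ` S)"
      unfolding rational_PL_convex_def by blast
    \<comment> \<open>The values of \<open>f\<close> are prescribed only on \<open>P\<close>;
      \<open>g\<close> is the same maximum on the whole space, where continuity and nonnegativity
      are wanted.\<close>
    define g where "g x = Max ((\<lambda>(a, c). a \<bullet> x + c) ` S)" for x
    have g_ge: "a \<bullet> x + c \<le> g x" if "(a, c) \<in> S" for a c x
      unfolding g_def using S that by (intro Max_ge) (auto intro: rev_image_eqI)
    have g_in: "\<exists>(a, c)\<in>S. g x = a \<bullet> x + c" for x
    proof -
      have "g x \<in> (\<lambda>(a, c). a \<bullet> x + c) ` S" unfolding g_def using S by (intro Max_in) auto
      then show ?thesis by auto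
    qed
    have g_cont: "continuous_on A g" for A unfolding g_def by (rule continuous_on_Max_affine[OF S])
    obtain a0 c0 where p: "(a0, c0) \<in> S" "g x0 = a0 \<bullet> x0 + c0" using g_in[of x0] by auto
    \<comment> \<open>The piece active at \<open>x0\<close> lies below \<open>g\<close> and touches
      it there, so subtracting it leaves a nonnegative function with a zero at
      \<open>x0\<close>.\<close>
    define l where "l x = - (a0 \<bullet> x + c0)" for x
    have "l = (\<lambda>x. (- a0) \<bullet> x + (- c0))" by (auto simp: l_def)
    then have l_aff: "l \<in> affine_fns" unfolding affine_fns_def by blast
    define \<phi> where "\<phi> x = g x + l x" for x
    have \<phi>_cont: "continuous_on A \<phi>" for A
      unfolding \<phi>_def by (intro continuous_intros g_cont affine_fns_continuous[OF l_aff])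
    have \<phi>_nonneg: "0 \<le> \<phi> x" for x using g_ge[OF p(1), of x] by (simp add: \<phi>_def l_def)
    have \<phi>_x0: "\<phi> x0 = 0" by (simp add: \<phi>_def l_def p(2))
    have \<phi>_chord: "\<phi> (x0 + u *\<^sub>R (y - x0)) \<le> u * \<phi> y" if u: "0 < u" "u \<le> 1" for y u
    proof -
      let ?x = "x0 + u *\<^sub>R (y - x0)"
      \<comment> \<open>The piece active at \<open>?x\<close> is affine on the segment and lies
        below \<open>g\<close> at both ends, which gives convexity.\<close>
      obtain a c where q: "(a, c) \<in> S" "g ?x = a \<bullet> ?x + c" using g_in[of ?x] by auto
      have "a \<bullet> ?x + c = (1 - u) * (a \<bullet> x0 + c) + u * (a \<bullet> y + c)"
        by (simp add: inner_add_right inner_diff_right algebra_simps)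
      also have "\<dots> \<le> (1 - u) * g x0 + u * g y"
        using u g_ge[OF q(1)] by (intro add_mono mult_left_mono) auto
      finally have "\<phi> ?x \<le> (1 - u) * \<phi> x0 + u * \<phi> y"
        unfolding \<phi>_def affine_fns_segment[OF l_aff] q(2) by (simp add: algebra_simps)
      then show ?thesis by (simp add: \<phi>_x0)
    qed
    have "PI (\<lambda>x. w x * \<phi> x) \<le> D * BI \<phi>"
      by (rule weighted_integral_le_boundary[OF x0 Dge _ c(2) w_cont w_le \<phi>_cont \<phi>_nonneg \<phi>_x0 \<phi>_chord])
        (use c in auto)
    \<comment> \<open>Splitting the weight isolates the volume term of \<open>L_V\<close>, leaving
      \<open>\<delta> * PI \<phi>\<close> as a lower bound for
      \<open>D * L_V r lam d \<phi>\<close>.\<close>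
    moreover have "PI (\<lambda>x. D * ((s + V x) * \<phi> x) + \<delta> * \<phi> x) = D * PI (\<lambda>x. (s + V x) * \<phi> x) + \<delta> * PI \<phi>"
      by (subst PI_add) (auto intro!: continuous_intros V_cont \<phi>_cont simp: PI_cmult)
    ultimately have "\<delta> * PI \<phi> \<le> D * L_V r lam d \<phi>"
      by (simp add: w_eq L_V_def algebra_simps)
    moreover have "J_norm r lam d f \<le> PI \<phi> / polytope_vol r lam d"
    proof -
      have "J_norm r lam d f = J_norm r lam d g" by (rule J_norm_cong) (simp add: fS g_def)
      then show ?thesis
        using J_norm_le[OF g_cont l_aff] \<phi>_nonneg by (simp add: \<phi>_def[abs_def])
    qed
    moreover have "L_V r lam d f = L_V r lam d \<phi>"
    proof -
      have "L_V r lam d f = L_V r lam d g" by (rule L_V_cong) (simp add: fS g_def)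
      then show ?thesis unfolding \<phi>_def using L_V_add_affine[OF g_cont l_aff] by simp
    qed
    ultimately have L: "\<delta> * PI \<phi> \<le> D * L_V r lam d f"
      and "J_norm r lam d f * polytope_vol r lam d \<le> PI \<phi>"
      using vol_pos by (simp_all add: pos_le_divide_eq)
    then have "\<delta> * (J_norm r lam d f * polytope_vol r lam d) \<le> D * L_V r lam d f"
      using \<delta> by (meson mult_left_mono less_imp_le order_trans)
    then show "\<delta> * polytope_vol r lam d / D * J_norm r lam d f \<le> L_V r lam d f"
      using D0 by (simp add: divide_le_eq mult.commute mult.left_commute)
  qed
qed

end

theorem theorem1p0p5:
  fixes r :: nat
    and lam :: "nat \<Rightarrow> int ^ 'n"
    and d :: "nat \<Rightarrow> int"
    and P :: "(real ^ 'n) set"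
    and V :: "real ^ 'n \<Rightarrow> real"
    and x0 :: "real ^ 'n"
    and d_x0 :: real
  assumes "integral_delzant r lam d"
    and "P = presented_polytope r lam d"
    and "V = extremal_fn r lam d"
    and "x0 \<in> interior P"
    and "d_x0 = Max ((\<lambda>j. support_fn lam d j x0) ` {1..r})"
    and "(\<forall>x\<in>P. V x = 0) \<and> s_bar r lam d < (real CARD('n) + 1) / d_x0 \<or>
         \<not> (\<forall>x\<in>P. V x = 0) \<and> s_bar r lam d + (SUP x\<in>P. V x) \<le> (real CARD('n) + 1) / d_x0"
  shows "uniformly_relatively_K_polystable r lam d"
proof -
  interpret delzant_presentation r lam d
    using assms(1) by unfold_locales
  show ?thesis
    using assms(4-6) unfolding assms(2,3) by (rule uniform_stability)
qed

end
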